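(* Let $X$ be a real reflexive Banach space with dual $X^*$, let $C\subset X$ be nonempty, closed and convex, and let $f:X\to\mathbb{R}$ be an admissible, strongly coercive Legendre function which is bounded, uniformly Fréchet differentiable and totally convex on bounded subsets of $X$. Let $g:C\times C\to\mathbb{R}$ be a bifunction with $g(x,x)=0$ for all $x\in C$ satisfying conditions (A1)–(A5) listed in the context, with Bregman–Lipschitz coefficients $c_1,c_2>0$ with respect to $f$. Let $S:C\to C$ be a Bregman nonexpansive mapping (with respect to $f$) with $\hat F(S)=F(S)$. Let $\varphi:C\times C\to\mathbb{R}$ be a bifunction satisfying conditions (B1)–(B4) listed in the context. Suppose $\Omega:=F(S)\cap EP(g)\cap F(\mathrm{Res}^f_\varphi)\neq\emptyset$. Suppose that $\{x_n\}$ is a sequence generated by $x_1\in C$, $u\in X$ and, for $n\ge 1$, $$ \begin{aligned} y_n&=\operatorname{argmin}\{\lambda_n g(x_n,y)+D_f(y,x_n): y\in C\},\\ z_n&=\operatorname{argmin}\{\lambda_n g(y_n,y)+D_f(y,x_n): y\in C\},\\ v_n&=\nabla f^*\big(\delta_n\nabla f(\mathrm{Res}^f_\varphi x_n)+(1-\delta_n)\nabla f(\mathrm{Res}^f_\varphi z_n)\big),\\ w_n&=\nabla f^*\big(\gamma_{n,1}\nabla f(v_n)+\gamma_{n,2}\nabla f(z_n)+\gamma_{n,3}\nabla f(Sz_n)\big),\\ u_n&\in C \text{ is such that } \varphi(u_n,y)+\langle \nabla f(u_n)-\nabla f(w_n),\,y-u_n\rangle\ge 0 \text{ for all } y\in C,\\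 k_n&=\nabla f^*\big(\beta_n\nabla f(w_n)+(1-\beta_n)\nabla f(Sw_n)\big),\\ h_n&=\nabla f^*\big(\alpha_{n,1}\nabla f(u)+\alpha_{n,2}\nabla f(x_n)+\alpha_{n,3}\nabla f(u_n)+\alpha_{n,4}\nabla f(k_n)\big),\\ x_{n+1}&=\overleftarrow{\mathrm{Proj}}{}_C^f\,h_n, \end{aligned} $$ where $\{\delta_n\}\subset(0,1)$ and: (i) $\{\alpha_{n,i}\}\subset(0,1)$ for $i=1,\dots,4$, $\sum_{i=1}^4\alpha_{n,i}=1$, $\lim_{n\to\infty}\alpha_{n,1}=0$, $\sum_{n=1}^\infty\alpha_{n,1}=\infty$, and $\liminf_{n\to\infty}\alpha_{n,i}\alpha_{n,j}>0$ for all $i\ne j$ with $2\le i,j\le 3$; (ii) $\{\gamma_{n,i}\}\subset(0,1)$ for $i=1,2,3$, $\gamma_{n,1}+\gamma_{n,2}+\gamma_{n,3}=1$, and $\liminf_{n\to\infty}\gamma_{n,i}\gamma_{n,j}>0$ for all $i\neq j$ with $1\le i,j\le 3$; (iii) $\{\lambda_n\}\subset[a,b]\subset(0,p)$, where $p=\min\{1/c_1,1/c_2\}$; (iv) $\{\beta_n\}\subset(0,1)$ and $\liminf_{n\to\infty}\beta_n(1-\beta_n)>0$. Then the sequence $\{x_n\}$ converges strongly (in norm) to $\overleftarrow{\mathrm{Proj}}{}_\Omega^f\,u$.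
   Context: Throughout, $\langle\cdot,\cdot\rangle$ is the duality pairing between $X$ and $X^*$. **Convex functions.** A function $f:X\to(-\infty,\infty]$ is *admissible* if it is proper, convex and lower semicontinuous. $f^*(l)=\sup\{\langle l,x\rangle-f(x):x\in X\}$ is its Fenchel conjugate on $X^*$. $\nabla f$ is the (Gâteaux) gradient: $\langle y,\nabla f(x)\rangle=\lim_{t\to0}\frac{f(x+ty)-f(x)}{t}$. $f$ is *uniformly Fréchet differentiable* on a set $B\subset X$ if this limit is attained uniformly for $x\in B$ and $\|y\|=1$. $f$ is *Legendre* (in reflexive $X$) if (L1) $\operatorname{int}\operatorname{dom}f\ne\emptyset$, $f$ is Gâteaux differentiable on $\operatorname{int}\operatorname{dom} f$ and $\operatorname{dom}\nabla f=\operatorname{int}\operatorname{dom}f$; and (L2) the same holds for $f^*$. In that case $\nabla f^*=(\nabla f)^{-1}$. $f$ is *strongly coercive* if $\lim_{\|x\|\to\infty}f(x)/\|x\|=\infty$. **Bregman distance.** $D_f(y,x)=f(y)-f(x)-\langle y-x,\nabla f(x)\rangle$. $f$ is *totally convex on bounded subsets* if for every nonempty bounded $B\subset X$ and every $t>0$, $\inf\{D_f(y,x): x\in B\cap\operatorname{int}\operatorname{dom}f,\ y\in\operatorname{dom}f,\ \|y-x\|=t\}>0$. **Bregman projection.** For a nonempty closed convex $K\subset X$, $\overleftarrow{\mathrm{Proj}}{}_K^f(x)$ is the unique element of $K$ with $D_f(\overleftarrow{\mathrm{Proj}}{}_K^f(x),x)=\inf\{D_f(y,x):y\in K\}$. **Equilibrium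 set.** $EP(g)=\{y^*\in C: g(x,y^* )\le 0\ \text{for all }x\in C\}$. **Conditions on $g$.** (A1) $g$ is monotone: $g(x,y)+g(y,x)\le0$ for all $x,y\in C$. (A2) $g$ is pseudomonotone: $g(x,y)\ge0\Rightarrow g(y,x)\le0$ for all $x,y\in C$. (A3) $g$ is Bregman–Lipschitz-type continuous: there are constants $c_1,c_2>0$ (the Bregman–Lipschitz coefficients with respect to $f$) with $g(x,y)+g(y,z)\ge g(x,z)-c_1D_f(y,x)-c_2D_f(z,y)$ for all $x,y,z\in C$. (A4) $g$ is weakly continuous on $C\times C$. (A5) for every fixed $x\in C$, $g(x,\cdot)$ is convex, lower semicontinuous and subdifferentiable on $C$. **Conditions on $\varphi$.** (B1) $\varphi(x,x)=0$ for all $x\in C$. (B2) $\varphi(x,y)+\varphi(y,x)\le0$ for all $x,y\in C$. (B3) $\lim_{t\downarrow0}\varphi(tz+(1-t)x,y)\le\varphi(x,y)$ for all $x,y,z\in C$. (B4) for all $x\in C$, $y\mapsto\varphi(x,y)$ is convex and lower semicontinuous. **Resolvent.** $\mathrm{Res}^f_\varphi x=\{z\in C:\varphi(z,y)+\langle\nabla f(z)-\nabla f(x),y-z\rangle\ge0\ \text{for all }y\in C\}$ for $x\in X$. Under the present assumptions on $f$ and $\varphi$ it is known to be nonempty and single-valued for every $x\in X$, and it is regarded as a map $X\to C$. **Fixed points.** $F(T)$ is the set of fixed points of a map $T$. $S:C\to C$ is *Bregman nonexpansive* if $D_f(Sx,Sy)\le D_f(x,y)$ for all $x,y\in C$. A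 point $x\in C$ is an *asymptotic fixed point* of $S$ if $C$ contains a sequence $\{x_n\}$ converging weakly to $x$ with $\|x_n-Sx_n\|\to0$; $\hat F(S)$ is the set of asymptotic fixed points. $\operatorname{argmin}$ denotes the unique minimizer of the given function over $C$.
   Formalization: The formal theorem adds the hypothesis that w_n lies in C for every n ≥ 1, since S is defined only on C and w_n, a combination formed through ∇f*, need not lie in C, so that S w_n would otherwise be undefined. *)

theory Defs
  imports "HOL-Analysis.Analysis"
begin

text \<open>
  The dual of a real normed space \<open>'a\<close> is the type \<open>'a \<Rightarrow>\<^sub>L real\<close> of bounded linear functionals;
  the pairing of \<open>l\<close> and \<open>x\<close> is \<open>blinfun_apply l x\<close>.  Functions with values in the half-open
  interval from minus infinity (excluded) to infinity (included) are \<open>ereal\<close>-valued; properness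
  excludes the value minus infinity.  A bifunction or self-map given only on \<open>C\<close> is a total
  function about whose values outside \<open>C\<close> nothing is assumed.
\<close>

section \<open>Reflexivity and weak convergence\<close>

definition bidual_embedding :: "'a::real_normed_vector \<Rightarrow> (('a \<Rightarrow>\<^sub>L real) \<Rightarrow>\<^sub>L real)" where
  "bidual_embedding x = Blinfun (\<lambda>l. blinfun_apply l x)"

text \<open>Intended use: \<open>reflexive_space TYPE('a)\<close>.\<close>

definition reflexive_space :: "'a::real_normed_vector itself \<Rightarrow> bool" where
  "reflexive_space _ \<longleftrightarrow> surj (bidual_embedding :: 'a \<Rightarrow> (('a \<Rightarrow>\<^sub>L real) \<Rightarrow>\<^sub>L real))"

definition weakly_tendsto :: "(nat \<Rightarrow> 'a::real_normed_vector) \<Rightarrow> 'a \<Rightarrow> bool" where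
  "weakly_tendsto s x \<longleftrightarrow>
     (\<forall>l :: 'a \<Rightarrow>\<^sub>L real. (\<lambda>n. blinfun_apply l (s n)) \<longlonglongrightarrow> blinfun_apply l x)"

section \<open>Convex functions\<close>

definition lsc_on :: "'a::topological_space set \<Rightarrow> ('a \<Rightarrow> 'b::linorder) \<Rightarrow> bool" where
  "lsc_on S f \<longleftrightarrow> (\<forall>x\<in>S. \<forall>r < f x. \<forall>\<^sub>F y in at x within S. r < f y)"

definition eff_dom :: "('a \<Rightarrow> ereal) \<Rightarrow> 'a set" where
  "eff_dom f = {x. f x < \<infinity>}"

definition proper :: "('a \<Rightarrow> ereal) \<Rightarrow> bool" where
  "proper f \<longleftrightarrow> (\<forall>x. f x \<noteq> -\<infinity>) \<and> eff_dom f \<noteq> {}"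

definition convex_ereal :: "('a::real_vector \<Rightarrow> ereal) \<Rightarrow> bool" where
  "convex_ereal f \<longleftrightarrow>
     (\<forall>x y. \<forall>t\<in>{0..1::real}.
        f ((1 - t) *\<^sub>R x + t *\<^sub>R y) \<le> ereal (1 - t) * f x + ereal t * f y)"

definition admissible :: "('a::real_normed_vector \<Rightarrow> ereal) \<Rightarrow> bool" where
  "admissible f \<longleftrightarrow> proper f \<and> convex_ereal f \<and> lsc_on UNIV f"

definition fenchel_conj ::
    "('a::real_normed_vector \<Rightarrow> ereal) \<Rightarrow> ('a \<Rightarrow>\<^sub>L real) \<Rightarrow> ereal" where
  "fenchel_conj f l = (SUP x. ereal (blinfun_apply l x) - f x)"

definition has_gateaux_gradient ::
    "('a::real_normed_vector \<Rightarrow> ereal) \<Rightarrow> ('a \<Rightarrow>\<^sub>L real) \<Rightarrow> 'a \<Rightarrow> bool" where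
  "has_gateaux_gradient f l x \<longleftrightarrow>
     \<bar>f x\<bar> \<noteq> \<infinity> \<and>
     (\<forall>y. ((\<lambda>t::real. (f (x + t *\<^sub>R y) - f x) / ereal t) \<longlongrightarrow> ereal (blinfun_apply l y)) (at 0))"

definition gateaux_differentiable :: "('a::real_normed_vector \<Rightarrow> ereal) \<Rightarrow> 'a \<Rightarrow> bool" where
  "gateaux_differentiable f x \<longleftrightarrow> (\<exists>l. has_gateaux_gradient f l x)"

definition gateaux_gradient :: "('a::real_normed_vector \<Rightarrow> ereal) \<Rightarrow> 'a \<Rightarrow> ('a \<Rightarrow>\<^sub>L real)" where
  "gateaux_gradient f x = (THE l. has_gateaux_gradient f l x)"

abbreviation grad :: "('a::real_normed_vector \<Rightarrow> real) \<Rightarrow> 'a \<Rightarrow> ('a \<Rightarrow>\<^sub>L real)" where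
  "grad f \<equiv> gateaux_gradient (\<lambda>x. ereal (f x))"

text \<open>
  The gradient of the conjugate at a point of the dual lives in the bidual; on a reflexive space
  it is read as an element of the space itself through the canonical embedding.
\<close>

definition grad_conj :: "('a::real_normed_vector \<Rightarrow> real) \<Rightarrow> ('a \<Rightarrow>\<^sub>L real) \<Rightarrow> 'a" where
  "grad_conj f l = inv bidual_embedding (gateaux_gradient (fenchel_conj (\<lambda>x. ereal (f x))) l)"

definition legendre_half :: "('a::real_normed_vector \<Rightarrow> ereal) \<Rightarrow> bool" where
  "legendre_half f \<longleftrightarrow>
     interior (eff_dom f) \<noteq> {} \<and>
     (\<forall>x\<in>interior (eff_dom f). gateaux_differentiable f x) \<and>
     {x. gateaux_differentiable f x} = interior (eff_dom f)"

definition legendre :: "('a::real_normed_vector \<Rightarrow> ereal) \<Rightarrow> bool" where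
  "legendre f \<longleftrightarrow> legendre_half f \<and> legendre_half (fenchel_conj f)"

definition strongly_coercive :: "('a::real_normed_vector \<Rightarrow> real) \<Rightarrow> bool" where
  "strongly_coercive f \<longleftrightarrow> filterlim (\<lambda>x. f x / norm x) at_top at_infinity"

definition bounded_on_bounded :: "('a::real_normed_vector \<Rightarrow> real) \<Rightarrow> bool" where
  "bounded_on_bounded f \<longleftrightarrow> (\<forall>B. bounded B \<longrightarrow> bounded (f ` B))"

definition uniformly_frechet_on :: "'a::real_normed_vector set \<Rightarrow> ('a \<Rightarrow> real) \<Rightarrow> bool" where
  "uniformly_frechet_on B f \<longleftrightarrow>
     uniform_limit (B \<times> sphere 0 1)
       (\<lambda>t (x, y). (f (x + t *\<^sub>R y) - f x) / t)
       (\<lambda>(x, y). blinfun_apply (grad f x) y)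
       (at 0)"

definition uniformly_frechet_on_bounded :: "('a::real_normed_vector \<Rightarrow> real) \<Rightarrow> bool" where
  "uniformly_frechet_on_bounded f \<longleftrightarrow> (\<forall>B. bounded B \<longrightarrow> uniformly_frechet_on B f)"

definition subdifferentiable_on :: "'a::real_normed_vector set \<Rightarrow> ('a \<Rightarrow> real) \<Rightarrow> bool" where
  "subdifferentiable_on C q \<longleftrightarrow>
     (\<forall>y\<in>C. \<exists>l :: 'a \<Rightarrow>\<^sub>L real. \<forall>z\<in>C. q z - q y \<ge> blinfun_apply l (z - y))"

section \<open>Bregman distance, total convexity, projection\<close>

definition bregman_dist :: "('a::real_normed_vector \<Rightarrow> real) \<Rightarrow> 'a \<Rightarrow> 'a \<Rightarrow> real" where
  "bregman_dist f y x = f y - f x - blinfun_apply (grad f x) (y - x)"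

text \<open>
  For a finite-valued \<open>f\<close> the effective domain is the whole space, so the side conditions
  that \<open>x\<close> lie in its interior and \<open>y\<close> in it are void.  The infimum is taken in \<open>ereal\<close>, where
  the infimum over the empty set is infinite.
\<close>

definition totally_convex_on_bounded :: "('a::real_normed_vector \<Rightarrow> real) \<Rightarrow> bool" where
  "totally_convex_on_bounded f \<longleftrightarrow>
     (\<forall>B t. B \<noteq> {} \<longrightarrow> bounded B \<longrightarrow> t > 0 \<longrightarrow>
        Inf {ereal (bregman_dist f y x) | x y. x \<in> B \<and> norm (y - x) = t} > 0)"

text \<open>
  The infimum is a real one; for convex, Gateaux differentiable \<open>f\<close> the Bregman distance is
  nonnegative, so it is a true infimum whenever \<open>K\<close> is nonempty.
\<close>

definition bregman_proj :: "('a::real_normed_vector \<Rightarrow> real) \<Rightarrow> 'a set \<Rightarrow> 'a \<Rightarrow> 'a" where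
  "bregman_proj f K x =
     (THE p. p \<in> K \<and> bregman_dist f p x = (INF y\<in>K. bregman_dist f y x))"

section \<open>Bifunctions\<close>

definition equilibrium_set :: "'a set \<Rightarrow> ('a \<Rightarrow> 'a \<Rightarrow> real) \<Rightarrow> 'a set" where
  "equilibrium_set C g = {p \<in> C. \<forall>x\<in>C. g x p \<le> 0}"

definition monotone_bifun :: "'a set \<Rightarrow> ('a \<Rightarrow> 'a \<Rightarrow> real) \<Rightarrow> bool" where
  "monotone_bifun C g \<longleftrightarrow> (\<forall>x\<in>C. \<forall>y\<in>C. g x y + g y x \<le> 0)"

definition pseudomonotone_bifun :: "'a set \<Rightarrow> ('a \<Rightarrow> 'a \<Rightarrow> real) \<Rightarrow> bool" where
  "pseudomonotone_bifun C g \<longleftrightarrow> (\<forall>x\<in>C. \<forall>y\<in>C. g x y \<ge> 0 \<longrightarrow> g y x \<le> 0)"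

definition bregman_lipschitz ::
    "('a::real_normed_vector \<Rightarrow> real) \<Rightarrow> 'a set \<Rightarrow> ('a \<Rightarrow> 'a \<Rightarrow> real) \<Rightarrow> real \<Rightarrow> real \<Rightarrow> bool" where
  "bregman_lipschitz f C g c1 c2 \<longleftrightarrow>
     c1 > 0 \<and> c2 > 0 \<and>
     (\<forall>x\<in>C. \<forall>y\<in>C. \<forall>z\<in>C.
        g x y + g y z \<ge> g x z - c1 * bregman_dist f y x - c2 * bregman_dist f z y)"

text \<open>
  Weak continuity of a bifunction is understood sequentially and jointly in both arguments, as
  usual for equilibrium problems; it is implied by continuity for the product weak topology.
\<close>

definition weakly_continuous_bifun ::
    "'a::real_normed_vector set \<Rightarrow> ('a \<Rightarrow> 'a \<Rightarrow> real) \<Rightarrow> bool" where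
  "weakly_continuous_bifun C g \<longleftrightarrow>
     (\<forall>s r x y. (\<forall>n. s n \<in> C) \<longrightarrow> (\<forall>n. r n \<in> C) \<longrightarrow> x \<in> C \<longrightarrow> y \<in> C \<longrightarrow>
        weakly_tendsto s x \<longrightarrow> weakly_tendsto r y \<longrightarrow>
        (\<lambda>n. g (s n) (r n)) \<longlonglongrightarrow> g x y)"

text \<open>The limit along \<open>t\<close> decreasing to 0 is allowed to be minus infinity.\<close>

definition upper_hemicontinuous_bifun ::
    "'a::real_vector set \<Rightarrow> ('a \<Rightarrow> 'a \<Rightarrow> real) \<Rightarrow> bool" where
  "upper_hemicontinuous_bifun C \<phi> \<longleftrightarrow>
     (\<forall>x\<in>C. \<forall>y\<in>C. \<forall>z\<in>C. \<exists>L::ereal.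
        ((\<lambda>t::real. ereal (\<phi> (t *\<^sub>R z + (1 - t) *\<^sub>R x) y)) \<longlongrightarrow> L) (at_right 0) \<and>
        L \<le> ereal (\<phi> x y))"

definition resolvent_set ::
    "('a::real_normed_vector \<Rightarrow> real) \<Rightarrow> 'a set \<Rightarrow> ('a \<Rightarrow> 'a \<Rightarrow> real) \<Rightarrow> 'a \<Rightarrow> 'a set" where
  "resolvent_set f C \<phi> x =
     {z \<in> C. \<forall>y\<in>C. \<phi> z y + blinfun_apply (grad f z - grad f x) (y - z) \<ge> 0}"

text \<open>The resolvent as a map: the single element of the set above.\<close>

definition resolvent ::
    "('a::real_normed_vector \<Rightarrow> real) \<Rightarrow> 'a set \<Rightarrow> ('a \<Rightarrow> 'a \<Rightarrow> real) \<Rightarrow> 'a \<Rightarrow> 'a" where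
  "resolvent f C \<phi> x = (THE z. z \<in> resolvent_set f C \<phi> x)"

section \<open>Fixed points\<close>

text \<open>\<open>D\<close> is the domain on which the map \<open>T\<close> is given.\<close>

definition fixed_points :: "'a set \<Rightarrow> ('a \<Rightarrow> 'a) \<Rightarrow> 'a set" where
  "fixed_points D T = {x \<in> D. T x = x}"

definition asymptotic_fixed_points ::
    "'a::real_normed_vector set \<Rightarrow> ('a \<Rightarrow> 'a) \<Rightarrow> 'a set" where
  "asymptotic_fixed_points C S =
     {x \<in> C. \<exists>s. (\<forall>n. s n \<in> C) \<and> weakly_tendsto s x \<and> (\<lambda>n. norm (s n - S (s n))) \<longlonglongrightarrow> 0}"

definition bregman_nonexpansive ::
    "('a::real_normed_vector \<Rightarrow> real) \<Rightarrow> 'a set \<Rightarrow> ('a \<Rightarrow> 'a) \<Rightarrow> bool" where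
  "bregman_nonexpansive f C S \<longleftrightarrow>
     S ` C \<subseteq> C \<and>
     (\<forall>x\<in>C. \<forall>y\<in>C. bregman_dist f (S x) (S y) \<le> bregman_dist f x y)"

end

theory Submission
  imports Defs "HOL-Complex_Analysis.Great_Picard"
begin

text \<open>
  Everything rests on the three point identity
  \<open>D z x = D z y + D y x + (\<nabla>f y - \<nabla>f x) (z - y)\<close>. It shows that for
  \<open>\<nabla>f w = (\<Sum>i. c\<^sub>i \<nabla>f x\<^sub>i)\<close> with weights summing to 1 one has
  \<open>(\<Sum>i. c\<^sub>i D p x\<^sub>i) = D p w + (\<Sum>i. c\<^sub>i D w x\<^sub>i)\<close>, so each averaging
  step of the scheme loses an explicit amount of Bregman distance to a point \<open>p\<close> of \<open>\<Omega>\<close>.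
  With \<open>p\<close> the projection of \<open>u\<close> onto \<open>\<Omega>\<close> this gives
  \<open>D p x\<^sub>n\<^sub>+\<^sub>1 \<le> (1 - \<alpha>\<^sub>n) D p x\<^sub>n + \<alpha>\<^sub>n b\<^sub>n - gap\<^sub>n\<close> where
  \<open>b\<^sub>n = (\<nabla>f u - \<nabla>f p) (h\<^sub>n - p)\<close> and \<open>gap\<^sub>n \<ge> 0\<close>. If \<open>gap\<^sub>n \<rightarrow> 0\<close> along a
  subsequence, then by total convexity all iterates come together in norm there, every weak cluster
  point lies in \<open>\<Omega>\<close>, and the variational inequality for \<open>p\<close> bounds \<open>b\<^sub>n\<close> asymptotically by 0.
  Hence \<open>gap\<^sub>n\<close> stays away from 0 whenever \<open>b\<^sub>n\<close> exceeds a given positive number, and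
  \<open>D p x\<^sub>n \<rightarrow> 0\<close> follows.

  Total convexity of \<open>f\<close> also replaces the theorems of Hahn-Banach, Mazur and Eberlein-Smulian:
  gradients of \<open>f\<close> separate points, \<open>\<nabla>f\<close> is onto the dual because \<open>f - l\<close> attains its minimum,
  and minimizing sequences converge in norm.
\<close>

section \<open>Bregman distances\<close>

lemma closed_sublevel:
  assumes "closed C" "lsc_on C (F :: 'a::metric_space \<Rightarrow> real)"
  shows "closed {z \<in> C. F z \<le> c}"
  unfolding closed_sequential_limits
proof (intro allI impI, elim conjE)
  fix s l assume s: "\<forall>n. s n \<in> {z \<in> C. F z \<le> c}" and l: "s \<longlonglongrightarrow> l"
  have lC: "l \<in> C" using assms(1) s l unfolding closed_sequential_limits by blast
  have "F l \<le> c"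
  proof (rule ccontr)
    assume "\<not> F l \<le> c"
    then have ev: "\<forall>\<^sub>F y in at l within C. c < F y" using assms(2) lC unfolding lsc_on_def by auto
    \<comment> \<open>The filter in \<open>lsc_on\<close> is punctured at \<open>l\<close>; the
      terms avoid \<open>l\<close> because \<open>F\<close> is at most \<open>c\<close> at them but
      exceeds \<open>c\<close> at \<open>l\<close>.\<close>
    have "s n \<noteq> l" for n using s \<open>\<not> F l \<le> c\<close> by (metis mem_Collect_eq)
    then have "filterlim s (at l within C) sequentially"
      using l s by (auto simp: filterlim_at)
    then have "\<forall>\<^sub>F n in sequentially. c < F (s n)" using ev unfolding filterlim_iff by blast
    then show False using s by (auto simp: eventually_sequentially not_less[symmetric])
  qed
  then show "l \<in> {z \<in> C. F z \<le> c}" using lC by simp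
qed

lemma lsc_on_add_continuous:
  assumes "continuous_on S f" "lsc_on S q"
  shows "lsc_on S (\<lambda>x. f x + q x :: real)"
  unfolding lsc_on_def
proof (intro ballI allI impI)
  fix x r assume x: "x \<in> S" and r: "r < f x + q x"
  define e where "e = (f x + q x - r) / 2"
  have e: "e > 0" using r by (simp add: e_def)
  have "(f \<longlongrightarrow> f x) (at x within S)" using assms(1) x by (simp add: continuous_on_def)
  then have "\<forall>\<^sub>F y in at x within S. f x - e < f y" using e by (intro order_tendstoD) auto
  moreover have "\<forall>\<^sub>F y in at x within S. q x - e < q y" using assms(2) x e unfolding lsc_on_def by simp
  ultimately show "\<forall>\<^sub>F y in at x within S. r < f y + q y"
    by eventually_elim (simp add: e_def field_simps)
qed

lemma lsc_on_continuous: "continuous_on S f \<Longrightarrow> lsc_on S (f :: _ \<Rightarrow> real)"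
  using lsc_on_add_continuous[of S f "\<lambda>_. 0"] by (simp add: lsc_on_def)

lemma lsc_on_cmult:
  assumes "c > 0" "lsc_on S q"
  shows "lsc_on S (\<lambda>x. c * q x :: real)"
  unfolding lsc_on_def
proof (intro ballI allI impI)
  fix x r assume x: "x \<in> S" and r: "r < c * q x"
  then have "r / c < q x" using assms(1) by (simp add: field_simps)
  then have "\<forall>\<^sub>F y in at x within S. r / c < q y" using assms(2) x unfolding lsc_on_def by blast
  then show "\<forall>\<^sub>F y in at x within S. r < c * q y"
    by eventually_elim (use assms(1) in \<open>simp add: field_simps\<close>)
qed

text \<open>Collects the hypotheses on \<open>f\<close> in real-valued form, with the Gateaux
  gradient given by its difference quotients. Reflexivity and the Legendre property are stated in
  the lemmas that use them.\<close>

locale bregman_function =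
  fixes f :: "'a::banach \<Rightarrow> real"
  assumes convex: "convex_on UNIV f"
    and directional: "((\<lambda>t. (f (x + t *\<^sub>R y) - f x) / t) \<longlongrightarrow> grad f x y) (at 0)"
    and coercive: "strongly_coercive f"
    and bounded_on_bounded: "bounded_on_bounded f"
    and uniformly_frechet: "uniformly_frechet_on_bounded f"
    and totally_convex: "totally_convex_on_bounded f"
begin

abbreviation G where "G \<equiv> grad f"
abbreviation D where "D \<equiv> bregman_dist f"

lemma subgradient: "f x + G x (y - x) \<le> f y"
proof -
  have lim: "((\<lambda>t. (f (x + t *\<^sub>R (y - x)) - f x) / t) \<longlongrightarrow> G x (y - x)) (at_right 0)"
    using directional by (rule filterlim_mono) (auto simp: at_le)
  have ev: "\<forall>\<^sub>F t in at_right 0. (f (x + t *\<^sub>R (y - x)) - f x) / t \<le> f y - f x"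
    unfolding eventually_at_right_field
  proof (intro exI[of _ 1] conjI allI impI)
    fix t :: real assume t: "0 < t" "t < 1"
    have "f ((1 - t) *\<^sub>R x + t *\<^sub>R y) \<le> (1 - t) * f x + t * f y"
      using t by (intro convex_onD[OF convex]) auto
    moreover have "(1 - t) *\<^sub>R x + t *\<^sub>R y = x + t *\<^sub>R (y - x)" by (simp add: algebra_simps)
    ultimately show "(f (x + t *\<^sub>R (y - x)) - f x) / t \<le> f y - f x"
      using t by (simp add: field_simps)
  qed simp
  show ?thesis using tendsto_upperbound[OF lim ev] by simp
qed

lemma D_nonneg [simp]: "0 \<le> D y x"
  using subgradient[of x y] by (simp add: bregman_dist_def)

lemma D_self [simp]: "D x x = 0"
  by (simp add: bregman_dist_def)

lemma three_point: "D z x = D z y + D y x + (G y - G x) (z - y)"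
  by (simp add: bregman_dist_def blinfun.bilinear_simps)

lemma D_symm_sum: "D x y + D y x = (G x - G y) (x - y)"
  by (simp add: bregman_dist_def blinfun.bilinear_simps)

text \<open>Along a ray from \<open>x\<close> the Bregman distance to \<open>x\<close> is convex, so the infimum over spheres in
  the definition of total convexity controls all points outside the ball.\<close>

lemma D_lower_bound:
  assumes "bounded B" "t > 0"
  obtains \<eta> where "\<eta> > 0" "\<And>x y. x \<in> B \<Longrightarrow> t \<le> norm (y - x) \<Longrightarrow> \<eta> \<le> D y x"
proof (cases "B = {}")
  case True
  then show ?thesis using that[of 1] by auto
next
  case False
  define I where "I = Inf {ereal (D y x) | x y. x \<in> B \<and> norm (y - x) = t}"
  have "I > 0" using totally_convex False assms unfolding totally_convex_on_bounded_def I_def by blast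
  then obtain \<eta> where \<eta>: "0 < ereal \<eta>" "ereal \<eta> < I" using ereal_dense2 by blast
  have sphere: "\<eta> \<le> D y x" if "x \<in> B" "norm (y - x) = t" for x y
  proof -
    have "I \<le> ereal (D y x)" unfolding I_def using that by (intro Inf_lower) auto
    then show ?thesis using \<eta>(2) by (metis ereal_less_eq(3) less_imp_le order_trans)
  qed
  show ?thesis
  proof (rule that[of \<eta>])
    show "\<eta> > 0" using \<eta> by simp
    fix x y assume x: "x \<in> B" and y: "t \<le> norm (y - x)"
    define s where "s = t / norm (y - x)"
    have "0 < norm (y - x)" using y assms(2) by linarith
    then have s: "0 < s" "s \<le> 1" using y assms(2) by (simp_all add: s_def)
    define y' where "y' = (1 - s) *\<^sub>R x + s *\<^sub>R y"
    have y'x: "y' - x = s *\<^sub>R (y - x)" by (simp add: y'_def algebra_simps)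
    have "norm (y' - x) = t" using \<open>0 < norm (y - x)\<close> assms(2) unfolding y'x s_def by simp
    then have "\<eta> \<le> D y' x" using sphere x by blast
    also have "\<dots> \<le> s * D y x"
    proof -
      have "f y' \<le> (1 - s) * f x + s * f y" unfolding y'_def using s by (intro convex_onD[OF convex]) auto
      then show ?thesis unfolding bregman_dist_def y'x
        by (simp add: blinfun.bilinear_simps algebra_simps)
    qed
    also have "\<dots> \<le> D y x" using s by (simp add: mult_left_le_one_le)
    finally show "\<eta> \<le> D y x" .
  qed
qed

text \<open>The bound of \<open>D_lower_bound\<close> is uniform over centres in a bounded set and
  asks nothing of the other point. Hence only the second argument of \<open>D\<close> has to stay
  bounded, which later covers a sequence whose boundedness is not yet known.\<close>

lemma D_tendsto_0_imp:
  assumes "bounded B" "\<And>n. X n \<in> B" "(\<lambda>n. D (Y n) (X n)) \<longlonglongrightarrow> 0"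
  shows "(\<lambda>n. Y n - X n) \<longlonglongrightarrow> 0"
proof (rule LIMSEQ_I)
  fix r :: real assume "0 < r"
  obtain \<eta> where \<eta>: "\<eta> > 0" "\<And>x y. x \<in> B \<Longrightarrow> r \<le> norm (y - x) \<Longrightarrow> \<eta> \<le> D y x"
    using D_lower_bound[OF assms(1) \<open>0 < r\<close>] by metis
  obtain N where "\<And>n. n \<ge> N \<Longrightarrow> D (Y n) (X n) < \<eta>"
    using order_tendstoD(2)[OF assms(3) \<eta>(1)] by (auto simp: eventually_sequentially)
  then show "\<exists>no. \<forall>n\<ge>no. norm (Y n - X n - 0) < r"
    using \<eta>(2) assms(2) by (metis diff_zero not_le)
qed

lemma D_eq_0_iff [simp]: "D y x = 0 \<longleftrightarrow> y = x"
proof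
  assume "D y x = 0"
  then have "(\<lambda>n::nat. y - x) \<longlonglongrightarrow> 0" by (intro D_tendsto_0_imp[of "{x}"]) auto
  then show "y = x" by (simp add: LIMSEQ_const_iff)
qed simp

text \<open>Strict monotonicity of the gradient: the pairing in the hypothesis equals
  \<open>D x y + D y x\<close>. The identification of points further on rests on this.\<close>

lemma grad_inj:
  assumes "(G x - G y) (x - y) \<le> 0"
  shows "x = y"
proof -
  have "D x y + D y x \<le> 0" using assms D_symm_sum by simp
  then have "D x y = 0" using D_nonneg[of x y] D_nonneg[of y x] by linarith
  then show ?thesis by simp
qed

section \<open>Bounds and continuity of the function and its gradient\<close>

lemma f_bounded:
  assumes "bounded B" obtains M where "\<And>x. x \<in> B \<Longrightarrow> \<bar>f x\<bar> \<le> M"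
proof -
  have "bounded (f ` B)" using assms bounded_on_bounded unfolding bounded_on_bounded_def by blast
  then show ?thesis using that unfolding bounded_iff by auto
qed

text \<open>In a unit direction \<open>e\<close> the subgradient inequality bounds
  \<open>G x e\<close> by \<open>f (x + e) - f x\<close>, and \<open>f\<close> is bounded on the
  ball of radius \<open>R + 1\<close>.\<close>

lemma grad_bounded:
  assumes "bounded B" obtains L where "L \<ge> 0" "\<And>x. x \<in> B \<Longrightarrow> norm (G x) \<le> L"
proof -
  obtain R where R: "\<And>x. x \<in> B \<Longrightarrow> norm x \<le> R" using assms by (auto simp: bounded_iff)
  obtain M where M: "\<And>x. x \<in> cball 0 (R + 1) \<Longrightarrow> \<bar>f x\<bar> \<le> M" using f_bounded[OF bounded_cball] by blast
  have "norm (G x) \<le> 2 * \<bar>M\<bar>" if x: "x \<in> B" for x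
  proof (rule norm_blinfun_bound)
    have *: "G x e \<le> 2 * \<bar>M\<bar>" if "norm e = 1" for e
    proof -
      have "norm (x + e) \<le> R + 1" using norm_triangle_ineq[of x e] R[OF x] that by simp
      then have "\<bar>f (x + e)\<bar> \<le> M" "\<bar>f x\<bar> \<le> M" using M[of "x + e"] M[of x] R[OF x] by auto
      moreover have "G x e \<le> f (x + e) - f x" using subgradient[of x "x + e"] by simp
      ultimately show ?thesis by linarith
    qed
    show "norm (G x y) \<le> 2 * \<bar>M\<bar> * norm y" for y
    proof (cases "y = 0")
      case False
      let ?e = "y /\<^sub>R norm y"
      have "\<bar>G x ?e\<bar> \<le> 2 * \<bar>M\<bar>" using *[of ?e] *[of "- ?e"] False by (auto simp: blinfun.minus_right)
      then show ?thesis using False by (simp add: blinfun.scaleR_right abs_mult field_simps)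
    qed simp
  qed simp
  then show ?thesis using that[of "2 * \<bar>M\<bar>"] by auto
qed

lemma f_lipschitz:
  assumes "bounded B" obtains L where "L \<ge> 0" "\<And>x y. x \<in> B \<Longrightarrow> y \<in> B \<Longrightarrow> \<bar>f x - f y\<bar> \<le> L * norm (x - y)"
proof -
  obtain L where L: "L \<ge> 0" "\<And>x. x \<in> B \<Longrightarrow> norm (G x) \<le> L" using grad_bounded[OF assms] by metis
  have *: "f x - f y \<le> L * norm (x - y)" if "x \<in> B" for x y
  proof -
    have "f x - f y \<le> G x (x - y)" using subgradient[of x y] by (simp add: blinfun.diff_right)
    also have "\<dots> \<le> norm (G x) * norm (x - y)" using norm_blinfun[of "G x" "x - y"] by simp
    also have "\<dots> \<le> L * norm (x - y)" using L(2)[OF that] by (intro mult_right_mono) auto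
    finally show ?thesis .
  qed
  show ?thesis
  proof (rule that[OF L(1)])
    fix x y assume "x \<in> B" "y \<in> B"
    then show "\<bar>f x - f y\<bar> \<le> L * norm (x - y)" using *[of x y] *[of y x] by (simp add: norm_minus_commute abs_le_iff)
  qed
qed

lemma f_continuous: "continuous_on UNIV f"
proof -
  have "isCont f x" for x
  proof -
    obtain L where L: "L \<ge> 0" "\<And>x' y. x' \<in> cball x 1 \<Longrightarrow> y \<in> cball x 1 \<Longrightarrow> \<bar>f x' - f y\<bar> \<le> L * norm (x' - y)"
      using f_lipschitz[OF bounded_cball] by metis
    have "((\<lambda>y. f y - f x) \<longlongrightarrow> 0) (at x)"
    proof (rule Lim_null_comparison)
      have "\<forall>\<^sub>F y in at x. y \<in> cball x 1"
        unfolding eventually_at by (intro exI[of _ 1]) (auto simp: dist_commute)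
      then show "\<forall>\<^sub>F y in at x. norm (f y - f x) \<le> L * norm (y - x)"
        by eventually_elim (use L(2) in auto)
      have "((\<lambda>y. L * norm (y - x)) \<longlongrightarrow> L * norm (x - x)) (at x)" by (intro tendsto_intros)
      then show "((\<lambda>y. L * norm (y - x)) \<longlongrightarrow> 0) (at x)" by simp
    qed
    then show ?thesis unfolding isCont_def using LIM_zero_iff by blast
  qed
  then show ?thesis by (simp add: continuous_on_eq_continuous_at)
qed

lemma D_continuous: "continuous_on S (\<lambda>y. D y x)"
  unfolding bregman_dist_def
  by (intro continuous_intros continuous_on_subset[OF f_continuous]) auto

text \<open>Uniform Frechet differentiability replaces the gradient on \<open>B\<close> by
  difference quotients with one common step \<open>t\<close>. For fixed \<open>t\<close> these are
  Lipschitz in the base point because \<open>f\<close> is.\<close>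

lemma grad_uniformly_continuous:
  assumes "bounded B" "e > 0"
  obtains d where "d > 0" "\<And>x y. x \<in> B \<Longrightarrow> y \<in> B \<Longrightarrow> norm (x - y) < d \<Longrightarrow> norm (G x - G y) \<le> e"
proof -
  obtain R where R: "\<And>x. x \<in> B \<Longrightarrow> norm x \<le> R" using assms by (auto simp: bounded_iff)
  obtain L where L: "L \<ge> 0" "\<And>x' y. x' \<in> cball 0 (R+1) \<Longrightarrow> y \<in> cball 0 (R+1) \<Longrightarrow> \<bar>f x' - f y\<bar> \<le> L * norm (x' - y)"
    using f_lipschitz[OF bounded_cball] by metis
  have "uniformly_frechet_on B f" using uniformly_frechet assms by (simp add: uniformly_frechet_on_bounded_def)
  then have "\<forall>\<^sub>F t in at 0. \<forall>p\<in>B \<times> sphere 0 1.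
      dist ((\<lambda>(x, y). (f (x + t *\<^sub>R y) - f x) / t) p) ((\<lambda>(x, y). G x y) p) < e / 4"
    unfolding uniformly_frechet_on_def by (intro uniform_limitD) (use assms in auto)
  then obtain d0 where d0: "d0 > 0" "\<And>t. t \<noteq> 0 \<Longrightarrow> dist t 0 < d0 \<Longrightarrow> \<forall>p\<in>B \<times> sphere 0 1.
      dist ((\<lambda>(x, y). (f (x + t *\<^sub>R y) - f x) / t) p) ((\<lambda>(x, y). G x y) p) < e / 4"
    unfolding eventually_at by auto
  define t where "t = min (d0 / 2) 1"
  have t: "0 < t" "t \<le> 1" "t < d0" using d0(1) by (auto simp: t_def)
  have near: "\<bar>(f (x + t *\<^sub>R y) - f x) / t - G x y\<bar> < e / 4" if "x \<in> B" "norm y = 1" for x y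
  proof -
    have "(x, y) \<in> B \<times> sphere 0 1" using that by simp
    then show ?thesis using d0(2)[of t] t by (force simp: dist_real_def)
  qed
  \<comment> \<open>Each of the two Lipschitz errors is at most \<open>e * t / 4\<close>, so the
    quotients differ by at most \<open>e / 2\<close>; the other half of \<open>e\<close> pays for
    the two replacements by \<open>near\<close>.\<close>
  define d where "d = e * t / (4 * (L + 1))"
  have d: "d > 0" using assms t L by (simp add: d_def)
  have "norm (G x - G x') \<le> e" if x: "x \<in> B" "x' \<in> B" "norm (x - x') < d" for x x'
  proof (rule norm_blinfun_bound)
    have *: "\<bar>(G x - G x') y\<bar> \<le> e" if y: "norm y = 1" for y
    proof -
      have in_ball: "x + t *\<^sub>R y \<in> cball 0 (R+1)" "x' + t *\<^sub>R y \<in> cball 0 (R+1)" "x \<in> cball 0 (R+1)" "x' \<in> cball 0 (R+1)"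
        using R[OF x(1)] R[OF x(2)] norm_triangle_ineq[of x "t *\<^sub>R y"] norm_triangle_ineq[of x' "t *\<^sub>R y"] y t by auto
      have "\<bar>f (x + t *\<^sub>R y) - f (x' + t *\<^sub>R y)\<bar> \<le> L * norm (x - x')" using L(2)[OF in_ball(1,2)] by simp
      moreover have "\<bar>f x - f x'\<bar> \<le> L * norm (x - x')" using L(2)[OF in_ball(3,4)] by simp
      moreover have "L * norm (x - x') \<le> e * t / 4"
      proof -
        have "L * norm (x - x') \<le> (L + 1) * d" using x(3) L by (intro mult_mono) auto
        also have "\<dots> = e * t / 4" using L by (simp add: d_def field_simps)
        finally show ?thesis .
      qed
      ultimately have "\<bar>(f (x + t *\<^sub>R y) - f x) - (f (x' + t *\<^sub>R y) - f x')\<bar> \<le> e * t / 2" by linarith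
      then have "\<bar>((f (x + t *\<^sub>R y) - f x) - (f (x' + t *\<^sub>R y) - f x')) / t\<bar> \<le> e / 2"
        using t by (simp add: abs_le_iff field_simps)
      then have "\<bar>(f (x + t *\<^sub>R y) - f x) / t - (f (x' + t *\<^sub>R y) - f x') / t\<bar> \<le> e / 2"
        by (simp add: diff_divide_distrib)
      then show ?thesis using near[OF x(1) y] near[OF x(2) y] unfolding blinfun.diff_left by linarith
    qed
    show "norm ((G x - G x') y) \<le> e * norm y" for y
    proof (cases "y = 0")
      case False
      have "\<bar>(G x - G x') (y /\<^sub>R norm y)\<bar> \<le> e" using False by (intro *) simp
      then show ?thesis using False by (simp add: blinfun.scaleR_right abs_mult field_simps)
    qed simp
  qed (use assms in simp)
  then show ?thesis using that d by blast
qed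

lemma grad_diff_tendsto_0:
  assumes "bounded B" "\<And>n. X n \<in> B" "\<And>n. Y n \<in> B" "(\<lambda>n. Y n - X n) \<longlonglongrightarrow> 0"
  shows "(\<lambda>n. G (Y n) - G (X n)) \<longlonglongrightarrow> 0"
proof (rule LIMSEQ_I)
  fix r :: real assume "0 < r"
  then obtain d where d: "d > 0" "\<And>x y. x \<in> B \<Longrightarrow> y \<in> B \<Longrightarrow> norm (x - y) < d \<Longrightarrow> norm (G x - G y) \<le> r / 2"
    using grad_uniformly_continuous[OF assms(1), of "r / 2"] by (metis half_gt_zero)
  then obtain N where "\<And>n. n \<ge> N \<Longrightarrow> norm (Y n - X n) < d"
    using LIMSEQ_D[OF assms(4) d(1)] by auto
  then show "\<exists>no. \<forall>n\<ge>no. norm (G (Y n) - G (X n) - 0) < r"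
    using d(2)[OF assms(3,2)] \<open>0 < r\<close> by (intro exI[of _ N]) (fastforce simp: field_simps)
qed

text \<open>The linear terms of the Bregman distances from \<open>x\<close> and from
  \<open>y\<close> to the midpoint cancel, so their sum is exactly the gap; total convexity bounds
  each of them below.\<close>

lemma midpoint_gap:
  assumes "bounded B" "t > 0"
  obtains \<eta> where "\<eta> > 0"
    "\<And>x y. x \<in> B \<Longrightarrow> y \<in> B \<Longrightarrow> t \<le> norm (x - y) \<Longrightarrow> 2 * f (midpoint x y) + \<eta> \<le> f x + f y"
proof -
  obtain R where R: "\<And>x. x \<in> B \<Longrightarrow> norm x \<le> R" using assms by (auto simp: bounded_iff)
  obtain \<eta> where \<eta>: "\<eta> > 0" "\<And>x y. x \<in> cball 0 R \<Longrightarrow> t / 2 \<le> norm (y - x) \<Longrightarrow> \<eta> \<le> D y x"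
    using D_lower_bound[OF bounded_cball, of "t / 2"] assms(2) by (metis half_gt_zero)
  show ?thesis
  proof (rule that[OF \<eta>(1)])
    fix x y assume xy: "x \<in> B" "y \<in> B" "t \<le> norm (x - y)"
    let ?m = "midpoint x y"
    have "norm (x + y) \<le> 2 * R" using norm_triangle_ineq[of x y] R xy by (smt (verit))
    then have m: "?m \<in> cball 0 R" by (simp add: midpoint_def)
    have xm: "x - ?m = (1/2) *\<^sub>R (x - y)" "y - ?m = (1/2) *\<^sub>R (y - x)"
      by (simp_all add: midpoint_def algebra_simps flip: scaleR_left.add)
    have "\<eta> \<le> D x ?m" "\<eta> \<le> D y ?m" using xy(3) by (auto intro!: \<eta>(2)[OF m] simp: xm norm_minus_commute)
    moreover have "D x ?m + D y ?m = f x + f y - 2 * f ?m"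
      unfolding bregman_dist_def xm by (simp add: blinfun.bilinear_simps field_simps)
    ultimately show "2 * f ?m + \<eta> \<le> f x + f y" using \<eta>(1) by linarith
  qed
qed

end

section \<open>Minimization, conjugate gradients and projections\<close>

text \<open>An elementary stand-in for an affine minorant: lower semicontinuity bounds
  \<open>q\<close> below near one point \<open>y0\<close>, and convexity along segments from
  \<open>y0\<close> lets \<open>q\<close> fall at most linearly beyond.\<close>

lemma convex_lsc_lower_bound:
  fixes q :: "'a::real_normed_vector \<Rightarrow> real"
  assumes "convex_on C q" "lsc_on C q"
  obtains A B where "\<And>z. z \<in> C \<Longrightarrow> - A - B * norm z \<le> q z"
proof (cases "C = {}")
  case True
  then show ?thesis using that by auto
next
  case False
  then obtain y0 where y0: "y0 \<in> C" by blast
  have "\<forall>\<^sub>F y in at y0 within C. q y0 - 1 < q y" using assms(2) y0 unfolding lsc_on_def by simp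
  then obtain d where d: "d > 0" "\<And>y. y \<in> C \<Longrightarrow> y \<noteq> y0 \<Longrightarrow> dist y y0 < d \<Longrightarrow> q y0 - 1 < q y"
    unfolding eventually_at by auto
  define r where "r = d / 2"
  have r: "0 < r" "r < d" using d(1) by (auto simp: r_def)
  show ?thesis
  proof (rule that)
    fix z assume z: "z \<in> C"
    have "q y0 - 1 - norm (z - y0) / r \<le> q z"
    proof (cases "norm (z - y0) < d")
      case True
      then have "q y0 - 1 \<le> q z" using d(2)[OF z] by (cases "z = y0") (auto simp: dist_norm less_imp_le)
      moreover have "0 \<le> norm (z - y0) / r" using r by simp
      ultimately show ?thesis by linarith
    next
      case False
      define n where "n = norm (z - y0)"
      have n: "r < n" "0 < n" using False r by (auto simp: n_def)
      define s where "s = r / n"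
      have s: "0 < s" "s \<le> 1" using n r by (auto simp: s_def)
      \<comment> \<open>The point of the segment at distance \<open>r\<close> from
        \<open>y0\<close>, still inside the neighbourhood where \<open>q\<close> exceeds
        \<open>q y0 - 1\<close>.\<close>
      define w where "w = (1 - s) *\<^sub>R y0 + s *\<^sub>R z"
      have "w \<in> C" unfolding w_def using convex_on_imp_convex[OF assms(1)] y0 z s by (simp add: convex_def)
      moreover have "norm (w - y0) = r"
      proof -
        have "w - y0 = s *\<^sub>R (z - y0)" by (simp add: w_def algebra_simps)
        then have "norm (w - y0) = s * n" using s(1) by (simp add: n_def)
        then show ?thesis using n by (simp add: s_def)
      qed
      ultimately have "q y0 - 1 < q w" using d(2)[of w] r by (auto simp: dist_norm)
      also have "q w \<le> (1 - s) * q y0 + s * q z"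
        unfolding w_def using s by (intro convex_onD[OF assms(1)] y0 z) auto
      finally have "s * (q y0 - q z) < 1" by (simp add: algebra_simps)
      then have "r * (q y0 - q z) < n" using n by (simp add: s_def field_simps)
      then have "q y0 - q z < n / r" using r by (simp add: field_simps)
      then show ?thesis by (simp add: n_def)
    qed
    moreover have "norm (z - y0) / r \<le> norm y0 / r + 1 / r * norm z"
    proof -
      have "norm (z - y0) / r \<le> (norm y0 + norm z) / r"
        using norm_triangle_ineq4[of z y0] r by (intro divide_right_mono) auto
      then show ?thesis by (simp add: add_divide_distrib)
    qed
    ultimately show "- (1 + norm y0 / r - q y0) - 1 / r * norm z \<le> q z" by linarith
  qed
qed

context bregman_function
begin

text \<open>By the midpoint gap, points of large finite intersections at which \<open>f\<close> is nearly minimal are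
  close together, so completeness replaces weak compactness.\<close>

lemma bounded_family_Inter_nonempty:
  fixes B :: "'a set"
  assumes B: "B \<in> \<F>" "bounded B"
    and closed: "\<And>K. K \<in> \<F> \<Longrightarrow> closed K"
    and mid: "\<And>K x y. K \<in> \<F> \<Longrightarrow> x \<in> K \<Longrightarrow> y \<in> K \<Longrightarrow> midpoint x y \<in> K"
    and fip: "\<And>\<A>. finite \<A> \<Longrightarrow> \<A> \<subseteq> \<F> \<Longrightarrow> \<Inter>\<A> \<noteq> {}"
  shows "\<Inter>\<F> \<noteq> {}"
proof -
  obtain M where M: "\<And>x. x \<in> B \<Longrightarrow> \<bar>f x\<bar> \<le> M" using f_bounded[OF B(2)] by blast
  \<comment> \<open>The threshold \<open>s\<close> of \<open>P\<close> is the supremum, over finite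
    subfamilies, of the infimum of \<open>f\<close> on their common part inside
    \<open>B\<close>.\<close>
  define P where "P c \<longleftrightarrow> (\<forall>\<A>. finite \<A> \<and> \<A> \<subseteq> \<F> \<longrightarrow> (\<exists>x \<in> B \<inter> \<Inter>\<A>. f x \<le> c))" for c
  have PM: "P M"
    unfolding P_def
  proof (intro allI impI)
    fix \<A> assume "finite \<A> \<and> \<A> \<subseteq> \<F>"
    then have "\<Inter>(insert B \<A>) \<noteq> {}" using B(1) by (intro fip) auto
    then obtain x where "x \<in> B \<inter> \<Inter>\<A>" by auto
    then show "\<exists>x \<in> B \<inter> \<Inter>\<A>. f x \<le> M" using M by (intro bexI[of _ x]) (auto simp: abs_le_iff)
  qed
  have below: "- M \<le> c" if Pc: "P c" for c
  proof -
    obtain x where "x \<in> B" "f x \<le> c" using Pc unfolding P_def by (force dest: spec[of _ "{}"])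
    then show ?thesis using M[of x] by linarith
  qed
  define s where "s = Inf {c. P c}"
  have bdd: "bdd_below {c. P c}" using below by (intro bdd_belowI) auto
  have above_s: "P (s + e)" if e: "e > 0" for e
  proof -
    have "Inf {c. P c} < s + e" using e by (simp add: s_def)
    then obtain c where "P c" "c < s + e" using PM by (auto dest!: cInf_lessD[rotated])
    then show ?thesis unfolding P_def by (meson less_imp_le order_trans)
  qed
  have below_s: "\<not> P (s - e)" if e: "e > 0" for e
  proof
    assume "P (s - e)"
    then have "s \<le> s - e" unfolding s_def using bdd by (intro cInf_lower) auto
    then show False using e by simp
  qed
  define \<epsilon> where "\<epsilon> n = inverse (real (Suc n))" for n
  have eps: "\<epsilon> n > 0" for n by (simp add: \<epsilon>_def)
  have "\<exists>\<A>. finite \<A> \<and> \<A> \<subseteq> \<F> \<and> (\<forall>x \<in> B \<inter> \<Inter>\<A>. s - \<epsilon> n < f x)" for n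
    using below_s[OF eps[of n]] unfolding P_def by (meson not_le)
  then obtain \<A> where \<A>: "\<And>n. finite (\<A> n)" "\<And>n. \<A> n \<subseteq> \<F>"
      "\<And>n x. x \<in> B \<inter> \<Inter>(\<A> n) \<Longrightarrow> s - \<epsilon> n < f x"
    by metis
  have close: "\<exists>N. \<forall>n\<ge>N. \<forall>x\<in>B \<inter> \<Inter>(\<A> n). \<forall>y\<in>B \<inter> \<Inter>(\<A> n).
      f x \<le> s + \<epsilon> n \<longrightarrow> f y \<le> s + \<epsilon> n \<longrightarrow> norm (x - y) < e" if e: "e > 0" for e
  proof -
    obtain \<eta> where \<eta>: "\<eta> > 0"
      "\<And>x y. x \<in> B \<Longrightarrow> y \<in> B \<Longrightarrow> e \<le> norm (x - y) \<Longrightarrow> 2 * f (midpoint x y) + \<eta> \<le> f x + f y"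
      using midpoint_gap[OF B(2) e] by metis
    obtain N where N: "4 * \<epsilon> N < \<eta>"
      using reals_Archimedean[of "\<eta> / 4"] \<eta>(1) by (auto simp: \<epsilon>_def field_simps)
    show ?thesis
    proof (intro exI[of _ N] allI impI ballI)
      fix n x y
      assume n: "N \<le> n" and xy: "x \<in> B \<inter> \<Inter>(\<A> n)" "y \<in> B \<inter> \<Inter>(\<A> n)" "f x \<le> s + \<epsilon> n" "f y \<le> s + \<epsilon> n"
      have "midpoint x y \<in> B \<inter> \<Inter>(\<A> n)" using xy(1,2) \<A>(2)[of n] mid B(1) by blast
      then have "s - \<epsilon> n < f (midpoint x y)" by (rule \<A>(3))
      moreover have "\<epsilon> n \<le> \<epsilon> N" using n by (simp add: \<epsilon>_def)
      ultimately have "\<not> 2 * f (midpoint x y) + \<eta> \<le> f x + f y" using xy(3,4) N by linarith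
      then show "norm (x - y) < e" using \<eta>(2)[of x y] xy by force
    qed
  qed
  \<comment> \<open>Intersecting over all levels up to \<open>n\<close> makes \<open>z n\<close>
    admissible at every earlier level, so \<open>close\<close> at one level controls the whole
    tail.\<close>
  have "\<exists>x \<in> B \<inter> \<Inter>(\<Union>k\<le>n. \<A> k). f x \<le> s + \<epsilon> n" for n
  proof -
    have "finite (\<Union>k\<le>n. \<A> k) \<and> (\<Union>k\<le>n. \<A> k) \<subseteq> \<F>" using \<A>(1,2) by blast
    then show ?thesis using above_s[OF eps[of n]] unfolding P_def by blast
  qed
  then obtain z where z: "\<And>n. z n \<in> B \<inter> \<Inter>(\<Union>k\<le>n. \<A> k)" "\<And>n. f (z n) \<le> s + \<epsilon> n" by metis
  have zA: "z n \<in> B \<inter> \<Inter>(\<A> k)" if "k \<le> n" for n k using z(1)[of n] that by auto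
  have zf: "f (z n) \<le> s + \<epsilon> k" if "k \<le> n" for n k
  proof -
    have "\<epsilon> n \<le> \<epsilon> k" using that by (simp add: \<epsilon>_def)
    then show ?thesis using z(2)[of n] by linarith
  qed
  have "Cauchy z"
  proof (rule CauchyI)
    fix e :: real assume "0 < e"
    from close[OF this] obtain N where "\<forall>x\<in>B \<inter> \<Inter>(\<A> N). \<forall>y\<in>B \<inter> \<Inter>(\<A> N).
      f x \<le> s + \<epsilon> N \<longrightarrow> f y \<le> s + \<epsilon> N \<longrightarrow> norm (x - y) < e" by blast
    then show "\<exists>M. \<forall>m\<ge>M. \<forall>n\<ge>M. norm (z m - z n) < e" using zA zf by (intro exI[of _ N]) blast
  qed
  then obtain l where l: "z \<longlonglongrightarrow> l" using Cauchy_convergent convergent_def by blast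
  have "l \<in> K" if K: "K \<in> \<F>" for K
  proof -
    \<comment> \<open>Adjoining \<open>K\<close> to the nearly optimal subfamily does not raise the
      threshold; the points found in \<open>K\<close> stay close to \<open>z n\<close> and so have
      the same limit.\<close>
    have "\<exists>x \<in> B \<inter> \<Inter>(insert K (\<A> n)). f x \<le> s + \<epsilon> n" for n
    proof -
      have "finite (insert K (\<A> n)) \<and> insert K (\<A> n) \<subseteq> \<F>" using \<A>(1,2) K by blast
      then show ?thesis using above_s[OF eps[of n]] unfolding P_def by blast
    qed
    then obtain z' where z': "\<And>n. z' n \<in> B \<inter> \<Inter>(insert K (\<A> n))" "\<And>n. f (z' n) \<le> s + \<epsilon> n" by metis
    have "(\<lambda>n. z' n - z n) \<longlonglongrightarrow> 0"
    proof (rule LIMSEQ_I)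
      fix e :: real assume "0 < e"
      from close[OF this] obtain N where N: "\<And>n x y. n \<ge> N \<Longrightarrow> x \<in>B \<inter> \<Inter>(\<A> n) \<Longrightarrow> y\<in>B \<inter> \<Inter>(\<A> n) \<Longrightarrow>
        f x \<le> s + \<epsilon> n \<Longrightarrow> f y \<le> s + \<epsilon> n \<Longrightarrow> norm (x - y) < e" by blast
      have "norm (z' n - z n - 0) < e" if "n \<ge> N" for n
        using N[OF that, of "z' n" "z n"] z'[of n] zA[of n n] z(2)[of n] by auto
      then show "\<exists>no. \<forall>n\<ge>no. norm (z' n - z n - 0) < e" by blast
    qed
    from tendsto_add[OF this l] have "z' \<longlonglongrightarrow> l" by simp
    moreover have "z' n \<in> K" for n using z'(1) by blast
    ultimately show ?thesis using closed[OF K] unfolding closed_sequential_limits by blast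
  qed
  then show ?thesis by blast
qed

section \<open>Coercivity and existence of minimizers\<close>

lemma coercive_bound:
  obtains R where "R \<ge> 1" "\<And>x. R \<le> norm x \<Longrightarrow> c * norm x \<le> f x"
proof -
  have "\<forall>\<^sub>F x in at_infinity. c \<le> f x / norm x"
    using coercive unfolding strongly_coercive_def filterlim_at_top by blast
  then obtain b where b: "\<And>x. b \<le> norm x \<Longrightarrow> c \<le> f x / norm x" unfolding eventually_at_infinity by blast
  show ?thesis
  proof (rule that[of "max b 1"])
    fix x :: 'a assume x: "max b 1 \<le> norm x"
    then have "0 < norm x" by linarith
    then show "c * norm x \<le> f x" using b[of x] x by (simp add: field_simps)
  qed simp
qed

lemma sublevel_bounded:
  assumes "\<And>z. z \<in> C \<Longrightarrow> - A - B * norm z \<le> q z"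
  shows "bounded {z \<in> C. f z + q z \<le> c}"
proof -
  obtain R where R: "R \<ge> 1" "\<And>x. R \<le> norm x \<Longrightarrow> (B + 1) * norm x \<le> f x" using coercive_bound by blast
  have "norm z \<le> max R (c + A)" if "z \<in> C" "f z + q z \<le> c" for z
  proof (cases "R \<le> norm z")
    case True
    have "(B + 1) * norm z - A - B * norm z \<le> c" using R(2)[OF True] assms[OF that(1)] that(2) by linarith
    then show ?thesis by (simp add: algebra_simps)
  qed simp
  then show ?thesis by (auto intro!: boundedI)
qed

text \<open>Among finitely many points the one with the least value of \<open>f + q\<close> lies in
  all their sublevel sets, so these have the finite intersection property, and coercivity bounds
  them. Only midpoints enter, so that \<open>C\<close> may be the closure of a rational
  span.\<close>

lemma minimizer_exists:
  fixes C :: "'a set"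
  assumes "C \<noteq> {}" "closed C" "lsc_on C q"
    and midC: "\<And>x y. x \<in> C \<Longrightarrow> y \<in> C \<Longrightarrow> midpoint x y \<in> C"
    and midq: "\<And>x y. x \<in> C \<Longrightarrow> y \<in> C \<Longrightarrow> q (midpoint x y) \<le> (q x + q y) / 2"
    and lower: "\<And>z. z \<in> C \<Longrightarrow> - A - B * norm z \<le> q z"
  obtains m where "m \<in> C" "\<And>y. y \<in> C \<Longrightarrow> f m + q m \<le> f y + q y"
proof -
  define H where "H y = f y + q y" for y
  define L where "L y = {z \<in> C. H z \<le> H y}" for y
  have midf: "f (midpoint x y) \<le> (f x + f y) / 2" for x y
    using convex_onD[OF convex, of "1/2" x y] by (simp add: midpoint_def algebra_simps)
  have lscH: "lsc_on C H" unfolding H_def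
    by (intro lsc_on_add_continuous assms continuous_on_subset[OF f_continuous]) auto
  obtain y0 where y0: "y0 \<in> C" using assms(1) by blast
  have "\<Inter>(L ` C) \<noteq> {}"
  proof (rule bounded_family_Inter_nonempty)
    show "L y0 \<in> L ` C" using y0 by blast
    show "bounded (L y0)" unfolding L_def H_def by (rule sublevel_bounded[OF lower])
    show "closed K" if "K \<in> L ` C" for K using that closed_sublevel[OF assms(2) lscH] by (auto simp: L_def)
    show "midpoint x y \<in> K" if K: "K \<in> L ` C" "x \<in> K" "y \<in> K" for K x y
    proof -
      obtain w where w: "K = L w" using K(1) by blast
      have "H (midpoint x y) \<le> (H x + H y) / 2"
        unfolding H_def using midf[of x y] midq[of x y] K w by (auto simp: L_def field_simps)
      then show ?thesis using K w midC[of x y] by (auto simp: L_def)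
    qed
    show "\<Inter>\<A> \<noteq> {}" if fin: "finite \<A>" "\<A> \<subseteq> L ` C" for \<A>
    proof -
      obtain Y where Y: "Y \<subseteq> C" "finite Y" "\<A> = L ` Y" using finite_subset_image[OF fin] by blast
      show ?thesis
      proof (cases "Y = {}")
        case True
        then show ?thesis using Y by simp
      next
        case False
        then obtain m where "m \<in> Y" "\<And>y. y \<in> Y \<Longrightarrow> H m \<le> H y"
          using arg_min_if_finite[OF Y(2) False, of H] by (metis not_le)
        then have "m \<in> \<Inter>\<A>" using Y by (auto simp: L_def)
        then show ?thesis by blast
      qed
    qed
  qed
  then obtain m where "m \<in> \<Inter>(L ` C)" by blast
  then show ?thesis using y0 by (intro that[of m]) (auto simp: L_def H_def)
qed

lemma convex_minimizer_exists:
  fixes C :: "'a set"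
  assumes "C \<noteq> {}" "closed C" "convex_on C q" "lsc_on C q"
  obtains m where "m \<in> C" "\<And>y. y \<in> C \<Longrightarrow> f m + q m \<le> f y + q y"
proof -
  obtain A B where AB: "\<And>z. z \<in> C \<Longrightarrow> - A - B * norm z \<le> q z"
    using convex_lsc_lower_bound[OF assms(3,4)] by blast
  have "convex C" using assms(3) by (rule convex_on_imp_convex)
  then have "midpoint x y \<in> C" if "x \<in> C" "y \<in> C" for x y
    using that by (simp add: midpoint_def scaleR_add_right convex_def)
  moreover have "q (midpoint x y) \<le> (q x + q y) / 2" if "x \<in> C" "y \<in> C" for x y
    using convex_onD[OF assms(3), of "1/2" x y] that by (simp add: midpoint_def algebra_simps)
  ultimately show ?thesis using minimizer_exists[OF assms(1,2,4) _ _ AB] that by blast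
qed

text \<open>Compare \<open>m\<close> with the points of the segment towards \<open>y\<close>:
  convexity of \<open>q\<close> isolates \<open>q y - q m\<close>, while the difference quotient of
  \<open>f\<close> tends to the gradient term.\<close>

lemma minimizer_optimality:
  assumes "convex_on C q" "m \<in> C" "\<And>y. y \<in> C \<Longrightarrow> f m + q m \<le> f y + q y" "y \<in> C"
  shows "0 \<le> q y - q m + G m (y - m)"
proof -
  have lim: "((\<lambda>t. (f (m + t *\<^sub>R (y - m)) - f m) / t) \<longlongrightarrow> G m (y - m)) (at_right 0)"
    using directional by (rule filterlim_mono) (auto simp: at_le)
  have ev: "\<forall>\<^sub>F t in at_right 0. q m - q y \<le> (f (m + t *\<^sub>R (y - m)) - f m) / t"
    unfolding eventually_at_right_field
  proof (intro exI[of _ 1] conjI allI impI)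
    fix t :: real assume t: "0 < t" "t < 1"
    let ?w = "(1 - t) *\<^sub>R m + t *\<^sub>R y"
    have "?w \<in> C" using convex_on_imp_convex[OF assms(1)] assms(2,4) t by (simp add: convex_def)
    then have "f m + q m \<le> f ?w + q ?w" by (rule assms(3))
    moreover have "q ?w \<le> (1 - t) * q m + t * q y" using t by (intro convex_onD[OF assms(1)] assms) auto
    moreover have "?w = m + t *\<^sub>R (y - m)" by (simp add: algebra_simps)
    ultimately have "t * (q m - q y) \<le> f (m + t *\<^sub>R (y - m)) - f m" by (simp add: algebra_simps)
    then show "q m - q y \<le> (f (m + t *\<^sub>R (y - m)) - f m) / t" using t by (simp add: field_simps)
  qed simp
  show ?thesis using tendsto_lowerbound[OF lim ev] by simp
qed

text \<open>A minimizer of \<open>f - l\<close> has gradient \<open>l\<close>: the optimality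
  condition holds in the directions \<open>e\<close> and \<open>- e\<close>.\<close>

lemma grad_surj: obtains x where "G x = l"
proof -
  have "convex_on UNIV (\<lambda>x. - l x)"
    by (rule convex_onI) (auto simp: blinfun.bilinear_simps algebra_simps)
  moreover have "lsc_on UNIV (\<lambda>x. - l x)" by (intro lsc_on_continuous continuous_intros)
  ultimately obtain m where m: "\<And>y. f m + - l m \<le> f y + - l y"
    using convex_minimizer_exists[of UNIV "\<lambda>x. - l x"] by auto
  have "0 \<le> (G m - l) e" for e
    using minimizer_optimality[OF \<open>convex_on UNIV (\<lambda>x. - l x)\<close> UNIV_I m UNIV_I, of "m + e"]
    by (simp add: blinfun.bilinear_simps)
  from this[of "e :: 'a" for e] have "(G m - l) e = 0" for e
    by (metis blinfun.minus_right neg_0_le_iff_le order_antisym)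
  then have "G m = l" by (intro blinfun_eqI) (simp add: blinfun.diff_left)
  then show ?thesis using that by blast
qed

section \<open>The bidual embedding and the gradient of the conjugate\<close>

lemma bidual_embedding_apply: "bidual_embedding (x :: 'a) l = l x"
  unfolding bidual_embedding_def by (simp add: bounded_linear_Blinfun_apply blinfun.bounded_linear_left)

lemma bidual_embedding_inj: "inj (bidual_embedding :: 'a \<Rightarrow> _)"
proof (rule injI)
  fix x y :: 'a assume "bidual_embedding x = bidual_embedding y"
  then have "l x = l y" for l :: "'a \<Rightarrow>\<^sub>L real" using bidual_embedding_apply[of x l] bidual_embedding_apply[of y l] by simp
  then have "(G x - G y) (x - y) \<le> 0" by (simp add: blinfun.diff_right)
  then show "x = y" by (rule grad_inj)
qed

text \<open>Choose \<open>x\<close> with \<open>G x = l\<close>. Fenchel equality makes the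
  conjugate finite everywhere and \<open>x\<close> a subgradient of it at \<open>l\<close>; the
  Legendre property supplies a Gateaux gradient there, which must then be the image of
  \<open>x\<close>.\<close>

lemma grad_grad_conj:
  assumes "legendre (\<lambda>x. ereal (f x))"
  shows "G (grad_conj f l) = l"
proof -
  obtain x where x: "G x = l" using grad_surj .
  let ?fc = "fenchel_conj (\<lambda>x. ereal (f x))"
  have val: "?fc (G w) = ereal (G w w - f w)" for w
    unfolding fenchel_conj_def
  proof (rule SUP_eqI)
    show "ereal (G w i) - ereal (f i) \<le> ereal (G w w - f w)" for i
      using subgradient[of w i] by (simp add: blinfun.diff_right)
    show "ereal (G w w - f w) \<le> y" if "\<And>i. i \<in> UNIV \<Longrightarrow> ereal (G w i) - ereal (f i) \<le> y" for y
      using that[of w] by simp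
  qed
  define F where "F m = real_of_ereal (?fc m)" for m
  have F: "?fc m = ereal (F m)" for m
  proof -
    obtain w where "G w = m" using grad_surj .
    then show ?thesis using val[of w] by (auto simp: F_def)
  qed
  have Fge: "m w - f w \<le> F m" for m :: "'a \<Rightarrow>\<^sub>L real" and w
  proof -
    have "ereal (m w) - ereal (f w) \<le> ?fc m" unfolding fenchel_conj_def by (rule SUP_upper) simp
    then show ?thesis by (simp add: F)
  qed
  have Fl: "F l = l x - f x" using val[of x] x F[of l] by simp
  have unique: "L = bidual_embedding x" if L: "has_gateaux_gradient ?fc L l" for L
  proof (rule blinfun_eqI)
    fix m
    have "((\<lambda>t::real. (?fc (l + t *\<^sub>R m) - ?fc l) / ereal t) \<longlongrightarrow> ereal (L m)) (at 0)"
      using L unfolding has_gateaux_gradient_def by blast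
    moreover have "\<forall>\<^sub>F t::real in at 0. (?fc (l + t *\<^sub>R m) - ?fc l) / ereal t = ereal ((F (l + t *\<^sub>R m) - F l) / t)"
      unfolding eventually_at by (intro exI[of _ 1]) (auto simp: F)
    ultimately have "((\<lambda>t::real. ereal ((F (l + t *\<^sub>R m) - F l) / t)) \<longlongrightarrow> ereal (L m)) (at 0)"
      by (rule Lim_transform_eventually)
    then have lim: "((\<lambda>t. (F (l + t *\<^sub>R m) - F l) / t) \<longlongrightarrow> L m) (at 0)" by (simp add: lim_ereal)
    \<comment> \<open>Dividing by positive and by negative \<open>t\<close> squeezes the derivative
      \<open>L m\<close> to the value \<open>m x\<close>.\<close>
    have inc: "t * m x \<le> F (l + t *\<^sub>R m) - F l" for t
      using Fge[of "l + t *\<^sub>R m" x] by (simp add: Fl blinfun.bilinear_simps)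
    have "m x \<le> L m"
    proof (rule tendsto_lowerbound)
      show "((\<lambda>t. (F (l + t *\<^sub>R m) - F l) / t) \<longlongrightarrow> L m) (at_right 0)"
        using lim by (rule filterlim_mono) (auto simp: at_le)
      show "\<forall>\<^sub>F t in at_right 0. m x \<le> (F (l + t *\<^sub>R m) - F l) / t"
        unfolding eventually_at_right_field using inc by (intro exI[of _ 1]) (auto simp: field_simps)
    qed simp
    moreover have "L m \<le> m x"
    proof (rule tendsto_upperbound)
      show "((\<lambda>t. (F (l + t *\<^sub>R m) - F l) / t) \<longlongrightarrow> L m) (at_left 0)"
        using lim by (rule filterlim_mono) (auto simp: at_le)
      show "\<forall>\<^sub>F t in at_left 0. (F (l + t *\<^sub>R m) - F l) / t \<le> m x"
        unfolding eventually_at_left_field using inc by (intro exI[of _ "-1"]) (auto simp: neg_divide_le_eq mult.commute)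
    qed simp
    ultimately show "L m = bidual_embedding x m" by (simp add: bidual_embedding_apply)
  qed
  have "eff_dom ?fc = UNIV" by (auto simp: eff_dom_def F)
  moreover have "legendre_half ?fc" using assms by (simp add: legendre_def)
  ultimately have "gateaux_differentiable ?fc l" unfolding legendre_half_def by simp
  then obtain L where "has_gateaux_gradient ?fc L l" unfolding gateaux_differentiable_def by blast
  with unique have "gateaux_gradient ?fc l = bidual_embedding x"
    unfolding gateaux_gradient_def by (metis the_equality)
  then show ?thesis using x bidual_embedding_inj by (simp add: grad_conj_def)
qed

text \<open>A bound on \<open>D p x\<close> and the bound on \<open>f\<close> near \<open>p\<close>
  control \<open>G x\<close> uniformly. The subgradient inequality at \<open>0\<close> then lets
  \<open>f x\<close> grow at most linearly with the norm of \<open>x\<close>, which coercivity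
  permits only on a bounded set.\<close>

lemma D_sublevel_bounded: "bounded {x. D p x \<le> M}"
proof -
  obtain K where K: "\<And>x. x \<in> cball 0 (norm p + 1) \<Longrightarrow> \<bar>f x\<bar> \<le> K" using f_bounded[OF bounded_cball] by blast
  define K' where "K' = \<bar>K\<bar> + \<bar>f p\<bar> + \<bar>M\<bar>"
  have gb: "norm (G x) \<le> K'" if x: "D p x \<le> M" for x
  proof (rule norm_blinfun_bound)
    have *: "G x e \<le> K'" if "norm e = 1" for e
    proof -
      have "\<bar>f (p + e)\<bar> \<le> K" using norm_triangle_ineq[of p e] that by (intro K) simp
      moreover have "f x + G x ((p - x) + e) \<le> f (p + e)" using subgradient[of x "p + e"] by (simp add: algebra_simps)
      ultimately show ?thesis using x unfolding bregman_dist_def K'_def blinfun.add_right by linarith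
    qed
    show "norm (G x y) \<le> K' * norm y" for y
    proof (cases "y = 0")
      case False
      let ?e = "y /\<^sub>R norm y"
      have "\<bar>G x ?e\<bar> \<le> K'" using *[of ?e] *[of "- ?e"] False by (auto simp: blinfun.minus_right)
      then show ?thesis using False by (simp add: blinfun.scaleR_right abs_mult field_simps)
    qed simp
  qed (simp add: K'_def)
  obtain R where R: "R \<ge> 1" "\<And>x. R \<le> norm x \<Longrightarrow> (K' + 1) * norm x \<le> f x" using coercive_bound by blast
  have "norm x \<le> max R (f 0)" if x: "D p x \<le> M" for x
  proof (cases "R \<le> norm x")
    case True
    have "f x \<le> f 0 + G x x" using subgradient[of x 0] by (simp add: blinfun.minus_right)
    also have "G x x \<le> norm (G x) * norm x" using norm_blinfun[of "G x" x] by simp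
    also have "\<dots> \<le> K' * norm x" using gb[OF x] by (intro mult_right_mono) auto
    finally have "norm x \<le> f 0" using R(2)[OF True] by (simp add: algebra_simps)
    then show ?thesis by simp
  qed simp
  then show ?thesis by (auto intro!: boundedI)
qed

text \<open>Up to a constant \<open>D y x\<close> is \<open>f y - G x y\<close>, so a minimizer
  exists and satisfies the variational inequality. With the three point identity this yields
  \<open>D y m + D m x \<le> D y x\<close>, which gives both minimality and uniqueness.\<close>

lemma bregman_proj_characterization:
  fixes K :: "'a set"
  assumes K: "K \<noteq> {}" "closed K" "convex K"
  shows bregman_proj_in: "bregman_proj f K x \<in> K"
    and bregman_proj_variational: "y \<in> K \<Longrightarrow> 0 \<le> (G (bregman_proj f K x) - G x) (y - bregman_proj f K x)"
proof -
  have cq: "convex_on K (\<lambda>y. - G x y)"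
    using K by (intro convex_onI) (auto simp: blinfun.bilinear_simps algebra_simps)
  moreover have "lsc_on K (\<lambda>y. - G x y)" by (intro lsc_on_continuous continuous_intros)
  ultimately obtain m where m: "m \<in> K" "\<And>y. y \<in> K \<Longrightarrow> f m + - G x m \<le> f y + - G x y"
    using convex_minimizer_exists[OF K(1,2)] by metis
  have vi: "0 \<le> (G m - G x) (y - m)" if "y \<in> K" for y
    using minimizer_optimality[OF cq m that] by (simp add: blinfun.bilinear_simps)
  have le: "D y m + D m x \<le> D y x" if "y \<in> K" for y
    using vi[OF that] three_point[of y x m] by linarith
  have inf: "(INF y\<in>K. D y x) = D m x"
  proof (rule cInf_eq_minimum)
    fix d assume "d \<in> (\<lambda>y. D y x) ` K"
    then obtain y where "y \<in> K" "d = D y x" by blast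
    then show "D m x \<le> d" using le[of y] D_nonneg[of y m] by linarith
  qed (use m in blast)
  have "bregman_proj f K x = m"
    unfolding bregman_proj_def inf
  proof (rule the_equality)
    fix p assume p: "p \<in> K \<and> D p x = D m x"
    then have "D p m = 0" using le[of p] D_nonneg[of p m] by linarith
    then show "p = m" by simp
  qed (use m in simp)
  then show "bregman_proj f K x \<in> K" "y \<in> K \<Longrightarrow> 0 \<le> (G (bregman_proj f K x) - G x) (y - bregman_proj f K x)"
    using m vi by auto
qed

lemma bregman_proj_pythagoras:
  fixes K :: "'a set"
  assumes "K \<noteq> {}" "closed K" "convex K" "y \<in> K"
  shows "D y (bregman_proj f K x) + D (bregman_proj f K x) x \<le> D y x"
  using bregman_proj_variational[OF assms, of x] three_point[of y x "bregman_proj f K x"] by linarith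

text \<open>Mazur's theorem, with the Bregman projection providing the separating functional.\<close>

lemma weakly_sequentially_closed:
  fixes K :: "'a set"
  assumes K: "closed K" "convex K" and s: "\<And>n. s n \<in> K" "weakly_tendsto s q"
  shows "q \<in> K"
proof -
  have ne: "K \<noteq> {}" using s by blast
  let ?P = "bregman_proj f K q"
  have "(\<lambda>n. (G ?P - G q) (s n)) \<longlonglongrightarrow> (G ?P - G q) q" using s(2) unfolding weakly_tendsto_def by blast
  moreover have "\<forall>n. (G ?P - G q) ?P \<le> (G ?P - G q) (s n)"
    using bregman_proj_variational[OF ne K s(1)] by (simp add: blinfun.diff_right)
  ultimately have "(G ?P - G q) ?P \<le> (G ?P - G q) q" by (intro LIMSEQ_le_const) auto
  then have "(G ?P - G q) (?P - q) \<le> 0" by (simp add: blinfun.diff_right)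
  then have "?P = q" by (rule grad_inj)
  then show ?thesis using bregman_proj_in[OF ne K, of q] by simp
qed

end

section \<open>Minimax for monotone bifunctions\<close>

text \<open>The weights proportional to the positive parts of the \<open>\<psi> y z\<close> give a point towards which
  the sum of squared positive parts decreases to first order, so its infimum is 0.\<close>

lemma finite_minty:
  fixes \<psi> :: "'a::real_vector \<Rightarrow> 'a \<Rightarrow> real"
  assumes C: "convex C" and Y: "finite Y" "Y \<subseteq> C" "Y \<noteq> {}"
    and conv: "\<And>y. y \<in> C \<Longrightarrow> convex_on C (\<psi> y)"
    and mono: "\<And>y z. y \<in> C \<Longrightarrow> z \<in> C \<Longrightarrow> \<psi> y z + \<psi> z y \<le> 0"
    and e: "e > 0"
  shows "\<exists>z\<in>C. \<forall>y\<in>Y. \<psi> y z \<le> e"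
proof -
  define \<nu> where "\<nu> y z = max 0 (\<psi> y z)" for y z
  define \<Phi> where "\<Phi> z = (\<Sum>y\<in>Y. (\<nu> y z)\<^sup>2)" for z
  define c where "c = Inf (\<Phi> ` C)"
  have Cne: "C \<noteq> {}" using Y by blast
  have \<nu>0: "0 \<le> \<nu> y z" for y z by (simp add: \<nu>_def)
  have \<Phi>0: "0 \<le> \<Phi> z" for z by (simp add: \<Phi>_def sum_nonneg)
  have c_le: "c \<le> \<Phi> z" if "z \<in> C" for z
    unfolding c_def using that \<Phi>0 by (intro cInf_lower bdd_belowI[of _ 0]) auto
  define M where "M = (\<Sum>y\<in>Y. \<Sum>w\<in>Y. \<bar>\<psi> y w\<bar>)"
  have \<psi>M: "\<bar>\<psi> y w\<bar> \<le> M" if "y \<in> Y" "w \<in> Y" for y w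
  proof -
    have "\<bar>\<psi> y w\<bar> \<le> (\<Sum>w\<in>Y. \<bar>\<psi> y w\<bar>)" using that Y by (intro member_le_sum) auto
    also have "\<dots> \<le> M" unfolding M_def using that Y
      by (intro member_le_sum[of y Y "\<lambda>y. \<Sum>w\<in>Y. \<bar>\<psi> y w\<bar>"]) (auto intro: sum_nonneg)
    finally show ?thesis .
  qed
  define K where "K = real (card Y) * M\<^sup>2"
  have K0: "0 \<le> K" by (simp add: K_def)
  \<comment> \<open>Moving from \<open>z\<close> by the fraction \<open>t\<close> towards the
    weighted point \<open>y'\<close> keeps the value at least \<open>c\<close>. If all positive
    parts vanish the weights are undefined, but then \<open>\<Phi> z = 0\<close>.\<close>
  have step: "c \<le> (1 - t)\<^sup>2 * \<Phi> z + t\<^sup>2 * K" if z: "z \<in> C" and t: "0 \<le> t" "t \<le> 1" for z t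
  proof (cases "(\<Sum>w\<in>Y. \<nu> w z) = 0")
    case True
    then have "\<nu> w z = 0" if "w \<in> Y" for w using that Y \<nu>0 by (simp add: sum_nonneg_eq_0_iff)
    then have "\<Phi> z = 0" by (simp add: \<Phi>_def)
    then have "c \<le> 0" using c_le[OF z] by simp
    also have "0 \<le> t\<^sup>2 * K" using K0 by simp
    finally show ?thesis using \<open>\<Phi> z = 0\<close> by simp
  next
    case False
    define N where "N = (\<Sum>w\<in>Y. \<nu> w z)"
    have N: "N > 0" using False \<nu>0 by (simp add: N_def order_less_le sum_nonneg)
    define \<mu> where "\<mu> w = \<nu> w z / N" for w
    have \<mu>: "0 \<le> \<mu> w" for w using \<nu>0 N by (simp add: \<mu>_def)
    have \<mu>1: "sum \<mu> Y = 1" using N by (simp add: \<mu>_def N_def flip: sum_divide_distrib)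
    define y' where "y' = (\<Sum>w\<in>Y. \<mu> w *\<^sub>R w)"
    have y': "y' \<in> C" unfolding y'_def using Y \<mu> \<mu>1 by (intro convex_sum C) auto
    define s where "s y = (\<Sum>w\<in>Y. \<mu> w * \<psi> y w)" for y
    have s_ge: "\<psi> y y' \<le> s y" if "y \<in> Y" for y
      unfolding s_def y'_def using Y \<mu> \<mu>1 that by (intro convex_on_sum[OF _ _ conv]) auto
    have s_abs: "\<bar>s y\<bar> \<le> M" if "y \<in> Y" for y
    proof -
      have "\<bar>s y\<bar> \<le> (\<Sum>w\<in>Y. \<mu> w * M)" unfolding s_def
        using \<mu> \<psi>M[OF that] by (intro order_trans[OF sum_abs] sum_mono) (auto simp: abs_mult intro!: mult_left_mono)
      then show ?thesis using \<mu>1 by (simp flip: sum_distrib_right)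
    qed
    \<comment> \<open>The weights are the normalized \<open>\<nu> w z\<close>, so this is a positive
      multiple of a quadratic form in them; symmetrized, monotonicity makes it nonpositive.\<close>
    have cross: "(\<Sum>y\<in>Y. \<nu> y z * s y) \<le> 0"
    proof -
      have "(\<Sum>y\<in>Y. \<mu> y * s y) = (\<Sum>y\<in>Y. \<Sum>w\<in>Y. \<mu> y * \<mu> w * \<psi> y w)"
        by (simp add: s_def sum_distrib_left mult.assoc)
      moreover have "\<dots> = (\<Sum>y\<in>Y. \<Sum>w\<in>Y. \<mu> y * \<mu> w * \<psi> w y)"
        by (subst sum.swap) (simp add: mult.commute)
      ultimately have "2 * (\<Sum>y\<in>Y. \<mu> y * s y) = (\<Sum>y\<in>Y. \<Sum>w\<in>Y. \<mu> y * \<mu> w * \<psi> y w) + (\<Sum>y\<in>Y. \<Sum>w\<in>Y. \<mu> y * \<mu> w * \<psi> w y)"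
        by simp
      also have "\<dots> = (\<Sum>y\<in>Y. \<Sum>w\<in>Y. \<mu> y * \<mu> w * (\<psi> y w + \<psi> w y))"
        by (simp add: sum.distrib distrib_left)
      also have "\<dots> \<le> 0"
        using \<mu> mono Y by (intro sum_nonpos mult_nonneg_nonpos) auto
      finally have "(\<Sum>y\<in>Y. \<mu> y * s y) \<le> 0" by simp
      moreover have "(\<Sum>y\<in>Y. \<nu> y z * s y) = N * (\<Sum>y\<in>Y. \<mu> y * s y)"
        using N by (simp add: \<mu>_def sum_distrib_left)
      ultimately show ?thesis using N by (simp add: mult_nonneg_nonpos)
    qed
    let ?z = "(1 - t) *\<^sub>R z + t *\<^sub>R y'"
    have "?z \<in> C" using C z y' t by (simp add: convex_def)
    have "c \<le> \<Phi> ?z" by (rule c_le[OF \<open>?z \<in> C\<close>])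
    also have "\<dots> \<le> (\<Sum>y\<in>Y. ((1 - t) * \<nu> y z + t * s y)\<^sup>2)"
      unfolding \<Phi>_def
    proof (rule sum_mono)
      fix y assume y: "y \<in> Y"
      have "\<psi> y ?z \<le> (1 - t) * \<psi> y z + t * \<psi> y y'"
        using t y Y z y' by (intro convex_onD[OF conv]) auto
      also have "\<dots> \<le> (1 - t) * \<nu> y z + t * s y"
        using t s_ge[OF y] by (intro add_mono mult_left_mono) (auto simp: \<nu>_def)
      finally have "\<bar>\<nu> y ?z\<bar> \<le> \<bar>(1 - t) * \<nu> y z + t * s y\<bar>" by (simp add: \<nu>_def)
      then show "(\<nu> y ?z)\<^sup>2 \<le> ((1 - t) * \<nu> y z + t * s y)\<^sup>2" by (simp add: abs_le_square_iff)
    qed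
    also have "\<dots> = (\<Sum>y\<in>Y. (1 - t)\<^sup>2 * (\<nu> y z)\<^sup>2 + 2 * t * (1 - t) * (\<nu> y z * s y) + t\<^sup>2 * (s y)\<^sup>2)"
      by (intro sum.cong) (auto simp: power2_eq_square algebra_simps)
    also have "\<dots> = (1 - t)\<^sup>2 * \<Phi> z + 2 * t * (1 - t) * (\<Sum>y\<in>Y. \<nu> y z * s y) + t\<^sup>2 * (\<Sum>y\<in>Y. (s y)\<^sup>2)"
      by (simp add: sum.distrib sum_distrib_left \<Phi>_def)
    also have "\<dots> \<le> (1 - t)\<^sup>2 * \<Phi> z + 0 + t\<^sup>2 * K"
    proof (intro add_mono mult_left_mono order_refl)
      show "2 * t * (1 - t) * (\<Sum>y\<in>Y. \<nu> y z * s y) \<le> 0" using cross t by (intro mult_nonneg_nonpos) auto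
      have "(s y)\<^sup>2 \<le> M\<^sup>2" if "y \<in> Y" for y using s_abs[OF that] by (metis abs_ge_zero power2_abs power_mono)
      then show "(\<Sum>y\<in>Y. (s y)\<^sup>2) \<le> K" unfolding K_def using sum_bounded_above[of Y "\<lambda>y. (s y)\<^sup>2" "M\<^sup>2"] by simp
    qed simp_all
    finally show ?thesis by simp
  qed
  \<comment> \<open>Taking the infimum over \<open>z\<close> turns \<open>step\<close> into
    \<open>c \<le> (1 - t)\<^sup>2 * c + t\<^sup>2 * K\<close>; after division by \<open>t\<close>,
    small \<open>t\<close> excludes a positive \<open>c\<close>.\<close>
  have c_step: "c * (2 - t) \<le> t * K" if t: "0 < t" "t < 1" for t
  proof -
    have "(c - t\<^sup>2 * K) / (1 - t)\<^sup>2 \<le> \<Phi> z" if "z \<in> C" for z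
      using step[OF that, of t] t by (simp add: divide_le_eq mult.commute)
    then have "(c - t\<^sup>2 * K) / (1 - t)\<^sup>2 \<le> c" unfolding c_def using Cne by (intro cInf_greatest) auto
    then have "c - t\<^sup>2 * K \<le> c * (1 - t)\<^sup>2" using t by (simp add: divide_le_eq)
    then have "t * (c * (2 - t)) \<le> t * (t * K)" by (simp add: power2_eq_square algebra_simps)
    then show ?thesis using t by simp
  qed
  have "c < e\<^sup>2"
  proof (rule ccontr)
    assume "\<not> c < e\<^sup>2"
    then have c: "c > 0" using e by (meson not_le order_less_le_trans zero_less_power)
    define t where "t = min (1/2) (c / (K + 1))"
    have t: "0 < t" using c K0 by (simp add: t_def)
    have t2: "t \<le> 1/2" "t \<le> c / (K + 1)" unfolding t_def by (rule min.cobounded1 min.cobounded2)+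
    have "c * 1 < c * (2 - t)" using c t2 by (intro mult_strict_left_mono) auto
    also have "\<dots> \<le> t * K" using c_step[of t] t t2 by simp
    also have "\<dots> \<le> c / (K + 1) * K" using t2 K0 by (intro mult_right_mono) auto
    also have "\<dots> \<le> c * 1" using K0 c by (simp add: divide_le_eq)
    finally show False by simp
  qed
  then obtain z where z: "z \<in> C" "\<Phi> z < e\<^sup>2"
    unfolding c_def using Cne cInf_lessD[of "\<Phi> ` C"] by auto
  have "\<psi> y z \<le> e" if "y \<in> Y" for y
  proof -
    have "(\<nu> y z)\<^sup>2 \<le> \<Phi> z" unfolding \<Phi>_def using that Y by (intro member_le_sum) auto
    then have "\<nu> y z < e" using z(2) e by (intro power2_less_imp_less[of "\<nu> y z" e]) auto
    then show ?thesis by (simp add: \<nu>_def)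
  qed
  then show ?thesis using z(1) by blast
qed

text \<open>Minty's argument: at a point of the segment from \<open>z\<close> to \<open>y\<close>,
  the zero diagonal and convexity turn the inequality tested at \<open>z\<close> into one tested at
  \<open>y\<close>; then the point tends to \<open>z\<close>. The perturbation \<open>h\<close>
  serves the resolvent, and \<open>h = 0\<close> the equilibrium set.\<close>

lemma minty_equilibrium:
  fixes C :: "'a::real_normed_vector set"
  assumes C: "convex C"
    and diag: "\<And>p. p \<in> C \<Longrightarrow> \<phi> p p = 0"
    and hemi: "upper_hemicontinuous_bifun C \<phi>"
    and conv: "\<And>p. p \<in> C \<Longrightarrow> convex_on C (\<phi> p)"
    and h: "convex_on C h" "continuous_on UNIV h"
    and z: "z \<in> C" "\<And>y. y \<in> C \<Longrightarrow> \<phi> y z + h z - h y \<le> 0"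
    and y: "y \<in> C"
  shows "0 \<le> \<phi> z y + h y - h z"
proof -
  define w where "w t = t *\<^sub>R y + (1 - t) *\<^sub>R z" for t :: real
  obtain L where L: "((\<lambda>t. ereal (\<phi> (w t) y)) \<longlongrightarrow> L) (at_right 0)" "L \<le> ereal (\<phi> z y)"
    using hemi z(1) y unfolding upper_hemicontinuous_bifun_def w_def by blast
  have "isCont (\<lambda>t. h (w t)) 0"
    unfolding w_def
    by (intro continuous_intros continuous_on_interior[OF continuous_on_compose2[OF h(2)], where S=UNIV] ) auto
  then have "((\<lambda>t. h (w t) - h y) \<longlongrightarrow> h (w 0) - h y) (at_right 0)"
    by (intro tendsto_intros) (simp add: isCont_def filterlim_at_split)
  then have lim: "((\<lambda>t. ereal (h (w t) - h y)) \<longlongrightarrow> ereal (h z - h y)) (at_right 0)"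
    by (simp add: lim_ereal w_def)
  have "\<forall>\<^sub>F t in at_right 0. ereal (h (w t) - h y) \<le> ereal (\<phi> (w t) y)"
    unfolding eventually_at_right_field
  proof (intro exI[of _ 1] conjI allI impI)
    fix t :: real assume t: "0 < t" "t < 1"
    have wC: "w t \<in> C" unfolding w_def using C z(1) y t by (simp add: convex_def)
    have w': "w t = (1 - t) *\<^sub>R z + t *\<^sub>R y" by (simp add: w_def)
    have "\<phi> (w t) (w t) \<le> (1 - t) * \<phi> (w t) z + t * \<phi> (w t) y"
      by (subst (2) w') (use t in \<open>intro convex_onD[OF conv[OF wC]] z y, auto\<close>)
    moreover have "h (w t) \<le> (1 - t) * h z + t * h y"
      unfolding w' using t by (intro convex_onD[OF h(1)] z y) auto
    moreover have "(1 - t) * (\<phi> (w t) z + h z - h (w t)) \<le> 0"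
      using z(2)[OF wC] t by (intro mult_nonneg_nonpos) auto
    ultimately have "0 \<le> t * (\<phi> (w t) y + h y - h (w t))" using diag[OF wC] by (simp add: algebra_simps)
    then show "ereal (h (w t) - h y) \<le> ereal (\<phi> (w t) y)" using t by (simp add: zero_le_mult_iff)
  qed simp
  from tendsto_le[OF _ L(1) lim this] have "ereal (h z - h y) \<le> L" by simp
  then have "ereal (h z - h y) \<le> ereal (\<phi> z y)" using L(2) by (rule order_trans)
  then show ?thesis by simp
qed

section \<open>Weak compactness and resolvents\<close>

context bregman_function
begin

text \<open>On the closed span of the sequence every functional agrees with some \<open>G y\<close>, where \<open>y\<close> lies in
  that span: minimize \<open>f - l\<close> there. Hence it suffices to make \<open>G d\<close> converge along the
  subsequence for \<open>d\<close> in a countable dense set.\<close>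

lemma weakly_convergent_subsequence:
  fixes s :: "nat \<Rightarrow> 'a"
  assumes refl: "reflexive_space TYPE('a)" and bd: "bounded (range s)"
  obtains r q where "strict_mono (r :: nat \<Rightarrow> nat)" "weakly_tendsto (s \<circ> r) q"
proof -
  obtain M where M: "\<And>n. norm (s n) \<le> M" using bd by (auto simp: bounded_iff)
  have M0: "0 \<le> M" using M[of 0] norm_ge_zero order_trans by blast
  \<comment> \<open>Rational combinations are encoded by lists of index and coefficient, which makes
    the span countable by its type.\<close>
  define comb :: "(nat \<times> rat) list \<Rightarrow> 'a" where
    "comb ps = sum_list (map (\<lambda>(n, c). of_rat c *\<^sub>R s n) ps)" for ps
  define K0 where "K0 = range comb"
  define K where "K = closure K0"
  have "countable K0" by (simp add: K0_def)
  have "comb ps + comb qs = comb (ps @ qs)" for ps qs by (simp add: comb_def)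
  then have add0: "x + y \<in> K0" if "x \<in> K0" "y \<in> K0" for x y using that unfolding K0_def by auto
  have "of_rat r *\<^sub>R comb ps = comb (map (\<lambda>(n, c). (n, r * c)) ps)" for r ps
    by (induction ps) (auto simp: comb_def scaleR_add_right of_rat_mult)
  then have scale0: "of_rat r *\<^sub>R x \<in> K0" if "x \<in> K0" for x r using that unfolding K0_def by auto
  have addK: "x + y \<in> K" if xy: "x \<in> K" "y \<in> K" for x y
  proof -
    obtain X Y where "\<And>n. X n \<in> K0" "X \<longlonglongrightarrow> x" "\<And>n. Y n \<in> K0" "Y \<longlonglongrightarrow> y"
      using xy unfolding K_def closure_sequential by auto
    then show ?thesis unfolding K_def closure_sequential
      by (intro exI[of _ "\<lambda>n. X n + Y n"]) (auto intro: add0 tendsto_add)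
  qed
  have scaleK: "of_rat r *\<^sub>R x \<in> K" if x: "x \<in> K" for x r
  proof -
    obtain X where "\<And>n. X n \<in> K0" "X \<longlonglongrightarrow> x" using x unfolding K_def closure_sequential by auto
    then show ?thesis unfolding K_def closure_sequential
      by (intro exI[of _ "\<lambda>n. of_rat r *\<^sub>R X n"]) (auto intro: scale0 tendsto_intros)
  qed
  have "s n = comb [(n, 1)]" for n by (simp add: comb_def)
  then have sK: "s n \<in> K" for n using closure_subset[of K0] unfolding K_def K0_def by blast
  have midK: "midpoint x y \<in> K" if "x \<in> K" "y \<in> K" for x y
  proof -
    have "real_of_rat (1/2) = inverse 2" by (simp add: of_rat_divide)
    then show ?thesis using scaleK[OF addK[OF that], of "1/2"] unfolding midpoint_def by metis
  qed
  \<comment> \<open>The normalization gives one bound \<open>M\<close> for all \<open>d\<close>, as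
    the diagonal subsequence theorem requires.\<close>
  define \<theta> where "\<theta> n d = G d (s n) / (1 + norm (G d))" for n d
  have \<theta>M: "norm (\<theta> n d) \<le> M" if "d \<in> K0" for n d
  proof -
    have pos: "0 < 1 + norm (G d)" by (simp add: add_pos_nonneg)
    have "\<bar>G d (s n)\<bar> \<le> norm (G d) * norm (s n)" using norm_blinfun[of "G d" "s n"] by simp
    also have "\<dots> \<le> (1 + norm (G d)) * M" using M[of n] M0 by (intro mult_mono) auto
    finally show ?thesis
      using pos by (simp add: \<theta>_def abs_divide pos_divide_le_eq mult.commute)
  qed
  obtain r where r: "strict_mono (r :: nat \<Rightarrow> nat)" "\<And>d. d \<in> K0 \<Longrightarrow> \<exists>l. (\<lambda>n. \<theta> (r n) d) \<longlonglongrightarrow> l"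
    using function_convergent_subsequence[of K0 \<theta> M, OF \<open>countable K0\<close> \<theta>M] by blast
  have conv0: "Cauchy (\<lambda>n. G d (s (r n)))" if "d \<in> K0" for d
  proof -
    have eq: "(1 + norm (G d)) * \<theta> n d = G d (s n)" for n
      using norm_ge_zero[of "G d"] by (simp add: \<theta>_def add_nonneg_eq_0_iff)
    obtain l where "(\<lambda>n. \<theta> (r n) d) \<longlonglongrightarrow> l" using r(2)[OF \<open>d \<in> K0\<close>] by blast
    then have "(\<lambda>n. (1 + norm (G d)) * \<theta> (r n) d) \<longlonglongrightarrow> (1 + norm (G d)) * l" by (intro tendsto_intros)
    then show ?thesis by (simp only: eq LIMSEQ_imp_Cauchy)
  qed
  have convK: "Cauchy (\<lambda>n. G y (s (r n)))" if y: "y \<in> K" for y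
  proof (rule CauchyI)
    fix e :: real assume e: "0 < e"
    \<comment> \<open>Replacing \<open>y\<close> by a nearby \<open>d\<close> costs at most
      \<open>e / 4\<close> at each of the two indices, leaving \<open>e / 2\<close> for the Cauchy
      estimate at \<open>d\<close>.\<close>
    define e' where "e' = e / (4 * (M + 1))"
    have e': "e' > 0" using e M0 by (simp add: e'_def)
    obtain \<delta> where \<delta>: "\<delta> > 0" "\<And>x x'. x \<in> cball y 1 \<Longrightarrow> x' \<in> cball y 1 \<Longrightarrow> norm (x - x') < \<delta> \<Longrightarrow> norm (G x - G x') \<le> e'"
      using grad_uniformly_continuous[OF bounded_cball e'] by metis
    obtain d where d: "d \<in> K0" "dist d y < min \<delta> 1"
      using y \<delta>(1) unfolding K_def closure_approachable by (metis min_less_iff_conj zero_less_one)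
    have "norm (G y - G d) \<le> e'" using d by (intro \<delta>(2)) (auto simp: dist_norm norm_minus_commute)
    have near: "\<bar>G y (s n) - G d (s n)\<bar> \<le> e / 4" for n
    proof -
      have "\<bar>(G y - G d) (s n)\<bar> \<le> norm (G y - G d) * norm (s n)" using norm_blinfun[of "G y - G d" "s n"] by simp
      also have "\<dots> \<le> e' * (M + 1)" using \<open>norm (G y - G d) \<le> e'\<close> M[of n] e' by (intro mult_mono) auto
      also have "\<dots> = e / 4" using M0 by (simp add: e'_def field_simps)
      finally show ?thesis by (simp add: blinfun.diff_left)
    qed
    obtain N where N: "\<And>m n. m \<ge> N \<Longrightarrow> n \<ge> N \<Longrightarrow> norm (G d (s (r m)) - G d (s (r n))) < e / 2"
      using CauchyD[OF conv0[OF d(1)], of "e / 2"] e by auto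
    have "norm (G y (s (r m)) - G y (s (r n))) < e" if "m \<ge> N" "n \<ge> N" for m n
      using N[OF that] near[of "r m"] near[of "r n"] unfolding real_norm_def by linarith
    then show "\<exists>N. \<forall>m\<ge>N. \<forall>n\<ge>N. norm (G y (s (r m)) - G y (s (r n))) < e" by blast
  qed
  have agree: "\<exists>y\<in>K. \<forall>n. G y (s n) = l (s n)" for l :: "'a \<Rightarrow>\<^sub>L real"
  proof -
    have lower: "- 0 - norm l * norm z \<le> - l z" for z using norm_blinfun[of l z] by (simp add: abs_le_iff)
    have lsc: "lsc_on K (\<lambda>y. - l y)" by (intro lsc_on_continuous continuous_intros)
    have mid: "- l (midpoint v w) \<le> (- l v + - l w) / 2" for v w
    proof -
      have "l (midpoint v w) = (l v + l w) / 2"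
        by (simp add: midpoint_def blinfun.scaleR_right blinfun.add_right)
      then show ?thesis by simp
    qed
    have K: "K \<noteq> {}" "closed K" using sK by (auto simp: K_def)
    obtain y where y: "y \<in> K" "\<And>w. w \<in> K \<Longrightarrow> f y + - l y \<le> f w + - l w"
      by (rule minimizer_exists[OF K lsc midK mid lower]) blast+
    \<comment> \<open>\<open>K\<close> is known to be closed only under rational multiples, so the
      derivative at \<open>y\<close> is taken along the steps \<open>1 / (k + 1)\<close>; it is
      applied to \<open>s n\<close> and \<open>- s n\<close>.\<close>
    have ge: "l e \<le> G y e" if e: "\<And>k::nat. y + (1 / real (Suc k)) *\<^sub>R e \<in> K" for e
    proof -
      have "(\<lambda>k. 1 / real (Suc k)) \<longlonglongrightarrow> 0"
        using LIMSEQ_inverse_real_of_nat by (simp only: inverse_eq_divide)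
      then have "filterlim (\<lambda>k. 1 / real (Suc k)) (at 0) sequentially" by (simp add: filterlim_at)
      from filterlim_compose[OF directional this]
      have lim: "(\<lambda>k. (f (y + (1 / real (Suc k)) *\<^sub>R e) - f y) / (1 / real (Suc k))) \<longlonglongrightarrow> G y e" .
      have "l e \<le> (f (y + (1 / real (Suc k)) *\<^sub>R e) - f y) / (1 / real (Suc k))" for k
        using y(2)[OF e[of k]] by (simp add: blinfun.bilinear_simps field_simps)
      then show ?thesis using lim by (intro LIMSEQ_le_const) auto
    qed
    have "G y (s n) = l (s n)" for n
    proof (rule antisym)
      have "y + (1 / real (Suc k)) *\<^sub>R (c *\<^sub>R s n) \<in> K" if "c = of_rat c'" for k c c'
      proof -
        have "real_of_rat (c' / of_nat (Suc k)) = c / real (Suc k)"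
          using that by (simp add: of_rat_divide del: of_nat_Suc)
        then show ?thesis using addK[OF y(1) scaleK[OF sK, of "c' / of_nat (Suc k)" n]] by simp
      qed
      from this[of 1 1] this[of "-1" "-1"] show "l (s n) \<le> G y (s n)" "G y (s n) \<le> l (s n)"
        using ge[of "s n"] ge[of "- s n"] by (auto simp: blinfun.minus_right)
    qed
    then show ?thesis using y(1) by blast
  qed
  have conv: "convergent (\<lambda>n. l (s (r n)))" for l :: "'a \<Rightarrow>\<^sub>L real"
  proof -
    obtain y where "y \<in> K" "\<And>n. G y (s n) = l (s n)" using agree[of l] by blast
    then show ?thesis using convK[of y] by (simp add: Cauchy_convergent_iff)
  qed
  define L :: "('a \<Rightarrow>\<^sub>L real) \<Rightarrow> real" where "L l = lim (\<lambda>n. l (s (r n)))" for l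
  have L: "(\<lambda>n. l (s (r n))) \<longlonglongrightarrow> L l" for l :: "'a \<Rightarrow>\<^sub>L real" using conv convergent_LIMSEQ_iff unfolding L_def by blast
  have "bounded_linear L"
  proof (rule bounded_linear_intro)
    show "L (l + l') = L l + L l'" for l l'
      using tendsto_add[OF L[of l] L[of l']] L[of "l + l'"] by (simp add: blinfun.add_left LIMSEQ_unique)
    show "L (c *\<^sub>R l) = c *\<^sub>R L l" for c l
      using tendsto_scaleR[OF tendsto_const L[of l], of c] L[of "c *\<^sub>R l"] by (simp add: blinfun.scaleR_left LIMSEQ_unique)
    show "norm (L l) \<le> norm l * M" for l
    proof (rule LIMSEQ_le_const2[OF tendsto_norm[OF L[of l]]])
      have "norm (l (s (r n))) \<le> norm l * M" for n
        using norm_blinfun[of l "s (r n)"] M[of "r n"] by (meson mult_left_mono norm_ge_zero order_trans)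
      then show "\<exists>N. \<forall>n\<ge>N. norm (l (s (r n))) \<le> norm l * M" by blast
    qed
  qed
  \<comment> \<open>Reflexivity enters here: the pointwise limit on the dual is evaluation at some
    \<open>q\<close>.\<close>
  obtain q where q: "Blinfun L = bidual_embedding q" using refl unfolding reflexive_space_def by (metis surjD)
  have "L l = l q" for l :: "'a \<Rightarrow>\<^sub>L real"
    using bidual_embedding_apply[of q l] bounded_linear_Blinfun_apply[OF \<open>bounded_linear L\<close>] by (simp flip: q)
  then have "weakly_tendsto (s \<circ> r) q" using L by (simp add: weakly_tendsto_def)
  then show ?thesis using that r(1) by blast
qed

text \<open>With \<open>h = f - G x\<close> the resolvent inequality is the optimality condition for
  an equilibrium problem with bifunction \<open>\<phi> z y + h y - h z\<close>. Its Minty form is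
  solved by intersecting sublevel sets, and \<open>minty_equilibrium\<close> returns to the original
  form.\<close>

lemma resolvent_set_nonempty:
  fixes C :: "'a set"
  assumes C: "C \<noteq> {}" "closed C" "convex C"
    and diag: "\<And>p. p \<in> C \<Longrightarrow> \<phi> p p = 0"
    and mono: "monotone_bifun C \<phi>"
    and hemi: "upper_hemicontinuous_bifun C \<phi>"
    and conv: "\<And>p. p \<in> C \<Longrightarrow> convex_on C (\<phi> p) \<and> lsc_on C (\<phi> p)"
  shows "resolvent_set f C \<phi> x \<noteq> {}"
proof -
  define h where "h y = f y - G x y" for y
  define \<psi> where "\<psi> y z = \<phi> y z + h z - h y" for y z
  have h_convex: "convex_on C h"
  proof -
    have "convex_on C (\<lambda>y. - G x y)"
      using C by (intro convex_onI) (auto simp: blinfun.bilinear_simps algebra_simps)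
    from convex_on_add[OF convex_on_subset[OF convex _ C(3)] this] show ?thesis by (simp add: h_def[abs_def])
  qed
  have h_cont: "continuous_on S h" for S
    unfolding h_def by (intro continuous_intros continuous_on_subset[OF f_continuous]) auto
  have \<psi>_lsc: "lsc_on C (\<psi> y)" if "y \<in> C" for y
  proof -
    have "lsc_on C (\<lambda>z. (h z - h y) + \<phi> y z)"
      using conv[OF that] by (intro lsc_on_add_continuous continuous_intros h_cont) auto
    then show ?thesis by (simp add: \<psi>_def[abs_def] algebra_simps)
  qed
  have \<psi>_convex: "convex_on C (\<psi> y)" if "y \<in> C" for y
  proof -
    have "convex_on C (\<lambda>z. (\<phi> y z + h z) + - h y)"
      using conv[OF that] h_convex C by (intro convex_on_add) (auto simp: convex_on_const)
    then show ?thesis by (simp add: \<psi>_def[abs_def])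
  qed
  have \<psi>_mono: "\<psi> y z + \<psi> z y \<le> 0" if "y \<in> C" "z \<in> C" for y z
    using mono that by (simp add: monotone_bifun_def \<psi>_def)
  \<comment> \<open>The positive slack \<open>e\<close> is there because \<open>finite_minty\<close>
    solves finitely many inequalities only approximately; intersecting over all \<open>e\<close>
    removes it.\<close>
  define S where "S = (\<lambda>(y, e). {z \<in> C. \<psi> y z \<le> e})"
  obtain y0 where y0: "y0 \<in> C" using C(1) by blast
  have "\<Inter>(S ` (C \<times> {0<..})) \<noteq> {}"
  proof (rule bounded_family_Inter_nonempty)
    show "S (y0, 1) \<in> S ` (C \<times> {0<..})" using y0 by auto
    obtain A B where AB: "\<And>z. z \<in> C \<Longrightarrow> - A - B * norm z \<le> \<phi> y0 z"
      using convex_lsc_lower_bound conv[OF y0] by metis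
    have "- A - (B + norm (G x)) * norm z \<le> \<phi> y0 z - G x z" if "z \<in> C" for z
      using AB[OF that] norm_blinfun[of "G x" z] unfolding real_norm_def distrib_right by linarith
    then have "bounded {z \<in> C. f z + (\<phi> y0 z - G x z) \<le> 1 + h y0}" by (rule sublevel_bounded)
    then show "bounded (S (y0, 1))" by (simp add: S_def \<psi>_def h_def algebra_simps)
    show "closed K" if "K \<in> S ` (C \<times> {0<..})" for K
      using that closed_sublevel[OF C(2) \<psi>_lsc] by (auto simp: S_def)
    show "midpoint z w \<in> K" if K: "K \<in> S ` (C \<times> {0<..})" "z \<in> K" "w \<in> K" for K z w
    proof -
      obtain y e where ye: "y \<in> C" "K = {z \<in> C. \<psi> y z \<le> e}" using K(1) by (auto simp: S_def)
      have "midpoint z w \<in> C"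
        using K ye(2) C(3) by (simp add: midpoint_def scaleR_add_right convex_def)
      moreover have "\<psi> y (midpoint z w) \<le> (1 - 1/2) * \<psi> y z + 1/2 * \<psi> y w"
      proof -
        have m: "midpoint z w = (1 - 1/2) *\<^sub>R z + (1/2) *\<^sub>R w"
          by (simp add: midpoint_def scaleR_add_right)
        show ?thesis unfolding m using K ye(2) by (intro convex_onD[OF \<psi>_convex[OF ye(1)]]) auto
      qed
      ultimately show ?thesis using K ye(2) by auto
    qed
    show "\<Inter>\<A> \<noteq> {}" if fin: "finite \<A>" "\<A> \<subseteq> S ` (C \<times> {0<..})" for \<A>
    proof -
      obtain P where P: "P \<subseteq> C \<times> {0<..}" "finite P" "\<A> = S ` P" using finite_subset_image[OF fin] by blast
      show ?thesis
      proof (cases "P = {}")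
        case True
        then show ?thesis using P by simp
      next
        case False
        define e where "e = Min (snd ` P)"
        have "e \<in> snd ` P" unfolding e_def using P(2) False by (intro Min_in) auto
        then have "e > 0" using P(1) by auto
        have "finite (fst ` P)" "fst ` P \<subseteq> C" "fst ` P \<noteq> {}" using P False by auto
        then have "\<exists>z\<in>C. \<forall>y\<in>fst ` P. \<psi> y z \<le> e"
          by (intro finite_minty C \<psi>_convex \<psi>_mono \<open>e > 0\<close>)
        then obtain z where z: "z \<in> C" "\<And>y. y \<in> fst ` P \<Longrightarrow> \<psi> y z \<le> e" by blast
        have "z \<in> S p" if "p \<in> P" for p
        proof -
          have "e \<le> snd p" unfolding e_def using P(2) that by (intro Min_le) auto
          then show ?thesis using z that by (force simp: S_def case_prod_beta)
        qed
        then show ?thesis using P by blast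
      qed
    qed
  qed
  then obtain z where z: "z \<in> \<Inter>(S ` (C \<times> {0<..}))" by blast
  then have zS: "z \<in> C" "\<psi> y z \<le> e" if "y \<in> C" "e > 0" for y e using that by (auto simp: S_def)
  have zC: "z \<in> C" using zS(1)[OF y0, of 1] by simp
  have "\<psi> y z \<le> 0" if "y \<in> C" for y
  proof (rule field_le_epsilon)
    fix e :: real assume "0 < e"
    then show "\<psi> y z \<le> 0 + e" using zS(2)[OF that] by simp
  qed
  then have le: "0 \<le> \<phi> z y + h y - h z" if "y \<in> C" for y
    using minty_equilibrium[OF C(3) diag hemi _ h_convex h_cont zC _ that] conv by (simp add: \<psi>_def)
  have q_convex: "convex_on C (\<lambda>y. \<phi> z y - G x y)"
  proof -
    have "convex_on C (\<lambda>y. - G x y)"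
      using C by (intro convex_onI) (auto simp: blinfun.bilinear_simps algebra_simps)
    from convex_on_add[OF _ this, of "\<phi> z"] show ?thesis using conv[OF zC] by simp
  qed
  have "0 \<le> \<phi> z y + (G z - G x) (y - z)" if "y \<in> C" for y
    using minimizer_optimality[OF q_convex zC _ that] le diag[OF zC]
    by (simp add: h_def blinfun.bilinear_simps algebra_simps)
  then have "z \<in> resolvent_set f C \<phi> x" using zC by (simp add: resolvent_set_def)
  then show ?thesis by blast
qed

lemma resolvent_set_unique:
  assumes mono: "monotone_bifun C \<phi>"
    and z: "z \<in> resolvent_set f C \<phi> x" "z' \<in> resolvent_set f C \<phi> x"
  shows "z = z'"
proof -
  have "0 \<le> \<phi> z z' + (G z - G x) (z' - z)" "0 \<le> \<phi> z' z + (G z' - G x) (z - z')" "\<phi> z z' + \<phi> z' z \<le> 0"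
    using z mono by (auto simp: resolvent_set_def monotone_bifun_def)
  then have "(G z - G z') (z - z') \<le> 0" by (simp add: blinfun.bilinear_simps)
  then show ?thesis by (rule grad_inj)
qed

lemma resolvent_in:
  assumes "monotone_bifun C \<phi>" "resolvent_set f C \<phi> x \<noteq> {}"
  shows "resolvent f C \<phi> x \<in> resolvent_set f C \<phi> x"
  unfolding resolvent_def using assms resolvent_set_unique by (metis (mono_tags, lifting) all_not_in_conv theI)

text \<open>Test the resolvent inequality at \<open>p\<close> and apply monotonicity and the three
  point identity. Formulated for any element of the set, it covers both \<open>resolvent\<close> and
  the iterates \<open>us\<close>.\<close>

lemma resolvent_set_D_le:
  assumes "monotone_bifun C \<phi>" "z \<in> resolvent_set f C \<phi> x" "p \<in> C" "\<And>y. y \<in> C \<Longrightarrow> 0 \<le> \<phi> p y"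
  shows "D p z + D z x \<le> D p x"
proof -
  have "z \<in> C" "0 \<le> \<phi> z p + (G z - G x) (p - z)" using assms by (auto simp: resolvent_set_def)
  moreover have "\<phi> z p + \<phi> p z \<le> 0" "0 \<le> \<phi> p z" using assms \<open>z \<in> C\<close> by (auto simp: monotone_bifun_def)
  ultimately show ?thesis using three_point[of p x z] by linarith
qed

end

section \<open>Convergence\<close>

text \<open>For large \<open>n\<close>, either \<open>b n \<le> c\<close>, or \<open>g n\<close> is
  bounded below and outweighs \<open>\<alpha> n * b n\<close>. In both cases the excess of
  \<open>a\<close> over \<open>c\<close> is contracted by
  \<open>1 - \<alpha> n \<le> exp (- \<alpha> n)\<close>, and divergence of the sum drives the
  product of the factors to 0.\<close>

lemma recursion_tendsto_0:
  fixes a \<alpha> b g :: "nat \<Rightarrow> real"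
  assumes step: "\<And>n. n \<ge> 1 \<Longrightarrow> a (Suc n) \<le> (1 - \<alpha> n) * a n + \<alpha> n * b n - g n"
    and a_nonneg: "\<And>n. 0 \<le> a n"
    and b_le: "\<And>n. n \<ge> 1 \<Longrightarrow> b n \<le> B"
    and g_nonneg: "\<And>n. n \<ge> 1 \<Longrightarrow> 0 \<le> g n"
    and \<alpha>: "\<And>n. n \<ge> 1 \<Longrightarrow> \<alpha> n \<in> {0<..<1}" "\<alpha> \<longlonglongrightarrow> 0"
      "filterlim (\<lambda>N. \<Sum>n=1..N. \<alpha> n) at_top sequentially"
    and gap: "\<And>c. c > 0 \<Longrightarrow> \<exists>\<epsilon>>0. \<exists>N. \<forall>n\<ge>N. c < b n \<longrightarrow> \<epsilon> \<le> g n"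
  shows "a \<longlonglongrightarrow> 0"
proof (rule LIMSEQ_I)
  fix e :: real assume "0 < e"
  define c where "c = e / 2"
  have c: "c > 0" using \<open>0 < e\<close> by (simp add: c_def)
  obtain \<epsilon> N where \<epsilon>: "\<epsilon> > 0" and N: "\<And>n. n \<ge> N \<Longrightarrow> c < b n \<Longrightarrow> \<epsilon> \<le> g n" using gap[OF c] by blast
  have "(\<lambda>n. \<alpha> n * \<bar>B\<bar>) \<longlonglongrightarrow> 0 * \<bar>B\<bar>" by (intro tendsto_intros \<alpha>)
  then have "\<forall>\<^sub>F n in sequentially. \<alpha> n * \<bar>B\<bar> < \<epsilon>" using \<epsilon> by (intro order_tendstoD(2)) auto
  then obtain N1 where N1: "\<And>n. n \<ge> N1 \<Longrightarrow> \<alpha> n * \<bar>B\<bar> < \<epsilon>" by (auto simp: eventually_sequentially)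
  have contr: "a (Suc n) - c \<le> (1 - \<alpha> n) * (a n - c)" if n: "n \<ge> max 1 (max N N1)" for n
  proof -
    have "\<alpha> n * b n - g n \<le> \<alpha> n * c"
    proof (cases "c < b n")
      case True
      have "\<alpha> n * b n \<le> \<alpha> n * \<bar>B\<bar>" using b_le[of n] \<alpha>(1)[of n] n by (intro mult_left_mono) auto
      moreover have "0 \<le> \<alpha> n * c" using \<alpha>(1)[of n] n c by simp
      ultimately show ?thesis using N[of n] N1[of n] n True by force
    next
      case False
      then have "\<alpha> n * b n \<le> \<alpha> n * c" using \<alpha>(1)[of n] n by (intro mult_left_mono) auto
      then show ?thesis using g_nonneg[of n] n by simp
    qed
    then show ?thesis using step[of n] n by (simp add: algebra_simps)
  qed
  define M where "M = max N N1"
  \<comment> \<open>The absolute value keeps the majorant nonnegative, so that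
    \<open>1 - \<alpha>\<close> may be replaced by the larger exponential factor.\<close>
  define K where "K = \<bar>a (Suc M) - c\<bar>"
  define T where "T n = (\<Sum>k=1..n. \<alpha> k)" for n
  have bound: "a (Suc (M + m)) - c \<le> K * exp (T M - T (M + m))" for m
  proof (induction m)
    case 0
    then show ?case by (simp add: K_def)
  next
    case (Suc m)
    let ?n = "Suc (M + m)"
    have "a (Suc ?n) - c \<le> (1 - \<alpha> ?n) * (a ?n - c)" unfolding M_def by (intro contr) linarith
    also have "\<dots> \<le> (1 - \<alpha> ?n) * (K * exp (T M - T (M + m)))"
      using Suc \<alpha>(1)[of ?n] by (intro mult_left_mono) auto
    also have "\<dots> \<le> exp (- \<alpha> ?n) * (K * exp (T M - T (M + m)))"
      using exp_ge_add_one_self[of "- \<alpha> ?n"] by (intro mult_right_mono) (auto simp: K_def)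
    also have "\<dots> = K * exp (T M - T (M + Suc m))"
      by (simp add: T_def exp_diff exp_add exp_minus field_simps)
    finally show ?case by simp
  qed
  have "filterlim (\<lambda>n. - T M + T n) at_top sequentially"
    using \<alpha>(3) unfolding T_def[abs_def] by (rule filterlim_tendsto_add_at_top[OF tendsto_const])
  then have "filterlim (\<lambda>n. - (- T M + T n)) at_bot sequentially" by (simp add: filterlim_uminus_at_bot)
  then have "(\<lambda>n. exp (T M - T n)) \<longlonglongrightarrow> 0"
    using filterlim_compose[OF exp_at_bot] by (simp add: algebra_simps)
  then have "(\<lambda>n. K * exp (T M - T n)) \<longlonglongrightarrow> K * 0" by (intro tendsto_intros)
  then have "\<forall>\<^sub>F n in sequentially. K * exp (T M - T n) < c" using c by (intro order_tendstoD(2)) auto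
  then obtain N2 where N2: "\<And>n. n \<ge> N2 \<Longrightarrow> K * exp (T M - T n) < c" by (auto simp: eventually_sequentially)
  show "\<exists>no. \<forall>n\<ge>no. norm (a n - 0) < e"
  proof (intro exI[of _ "Suc (M + N2)"] allI impI)
    fix n assume "n \<ge> Suc (M + N2)"
    then have "n = Suc (M + (n - Suc M))" "n - Suc M \<ge> N2" by auto
    then obtain m where m: "n = Suc (M + m)" "m \<ge> N2" by blast
    have "a n - c < c" using bound[of m] N2[of "M + m"] m by force
    then show "norm (a n - 0) < e" using a_nonneg[of n] by (simp add: c_def)
  qed
qed

section \<open>Closedness and convexity of equilibrium sets\<close>

lemma convex_sublevel:
  assumes "convex_on C F"
  shows "convex {z \<in> C. F z \<le> c}"
proof (rule convexI)
  fix x y and u v :: real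
  assume xy: "x \<in> {z \<in> C. F z \<le> c}" "y \<in> {z \<in> C. F z \<le> c}" and uv: "0 \<le> u" "0 \<le> v" "u + v = 1"
  have "F (u *\<^sub>R x + v *\<^sub>R y) \<le> max (F x) (F y)" using xy uv by (intro convex_lower[OF assms]) auto
  moreover have "u *\<^sub>R x + v *\<^sub>R y \<in> C"
    using convex_on_imp_convex[OF assms] xy uv by (auto intro: convexD)
  ultimately show "u *\<^sub>R x + v *\<^sub>R y \<in> {z \<in> C. F z \<le> c}" using xy by auto
qed

lemma equilibrium_set_closed_convex:
  fixes C :: "'a::real_normed_vector set"
  assumes "closed C" "convex C" "\<And>p. p \<in> C \<Longrightarrow> convex_on C (g p) \<and> lsc_on C (g p)"
  shows "closed (equilibrium_set C g)" "convex (equilibrium_set C g)"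
proof -
  have eq: "equilibrium_set C g = C \<inter> (\<Inter>x\<in>C. {p \<in> C. g x p \<le> 0})"
    by (auto simp: equilibrium_set_def)
  show "closed (equilibrium_set C g)"
    unfolding eq using assms by (intro closed_Int closed_INT ballI closed_sublevel) auto
  show "convex (equilibrium_set C g)"
    unfolding eq using assms by (intro convex_Int convex_INT convex_sublevel) auto
qed

lemma equilibrium_set_nonneg:
  fixes C :: "'a::real_normed_vector set"
  assumes "convex C" "\<And>p. p \<in> C \<Longrightarrow> \<phi> p p = 0" "upper_hemicontinuous_bifun C \<phi>"
    "\<And>p. p \<in> C \<Longrightarrow> convex_on C (\<phi> p)" "q \<in> equilibrium_set C \<phi>" "y \<in> C"
  shows "0 \<le> \<phi> q y"
  using minty_equilibrium[of C \<phi> "\<lambda>_. 0" q y] assms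
  by (auto simp: equilibrium_set_def convex_on_const)

section \<open>Elementary facts on limits\<close>

lemma weakly_tendsto_add_null:
  assumes "weakly_tendsto s q" "(\<lambda>n. t n - s n) \<longlonglongrightarrow> 0"
  shows "weakly_tendsto t q"
  unfolding weakly_tendsto_def
proof
  fix l :: "'a \<Rightarrow>\<^sub>L real"
  have "(\<lambda>n. l (t n - s n)) \<longlonglongrightarrow> l 0" by (intro tendsto_intros assms)
  from tendsto_add[OF this, of "\<lambda>n. l (s n)" "l q"] show "(\<lambda>n. l (t n)) \<longlonglongrightarrow> l q"
    using assms(1) by (simp add: weakly_tendsto_def blinfun.diff_right)
qed

lemma weakly_tendsto_const: "weakly_tendsto (\<lambda>_. q) q"
  by (simp add: weakly_tendsto_def)

lemma blinfun_apply_tendsto_0: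
  assumes "l \<longlonglongrightarrow> 0" "bounded (range v)"
  shows "(\<lambda>n. blinfun_apply (l n) (v n) :: real) \<longlonglongrightarrow> 0"
proof -
  obtain R where R: "\<And>n. norm (v n) \<le> R" using assms(2) by (auto simp: bounded_iff)
  have "(\<lambda>n. norm (l n) * R) \<longlonglongrightarrow> 0 * R"
    using assms(1) by (intro tendsto_intros) (simp add: tendsto_norm_zero)
  moreover have "norm (l n (v n)) \<le> norm (l n) * R" for n
    using norm_blinfun[of "l n" "v n"] R[of n] by (meson mult_left_mono norm_ge_zero order_trans)
  ultimately show ?thesis by (intro Lim_null_comparison[of "\<lambda>n. l n (v n)" "\<lambda>n. norm (l n) * R"]) auto
qed

lemma squeeze_to_0:
  fixes A B :: "nat \<Rightarrow> real"
  assumes "\<And>k. 0 \<le> A k" "\<And>k. e * A k \<le> B k" "e > 0" "B \<longlonglongrightarrow> 0"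
  shows "A \<longlonglongrightarrow> 0"
proof (rule tendsto_sandwich[of "\<lambda>_. 0" _ _ "\<lambda>k. B k / e"])
  show "\<forall>\<^sub>F k in sequentially. A k \<le> B k / e" using assms(2,3) by (simp add: field_simps)
  show "(\<lambda>k. B k / e) \<longlonglongrightarrow> 0" using tendsto_divide[OF assms(4) tendsto_const[of e]] assms(3) by simp
qed (use assms(1) in auto)

text \<open>Both factors lie below 1, so each of them is at least the product.\<close>

lemma liminf_product_pos:
  assumes "liminf (\<lambda>n. ereal (s n * t n)) > 0"
    and "\<And>n. n \<ge> 1 \<Longrightarrow> s n \<in> {0<..<1::real}" "\<And>n. n \<ge> 1 \<Longrightarrow> t n \<in> {0<..<1::real}"
  obtains e N where "e > 0" "\<And>n. n \<ge> N \<Longrightarrow> e \<le> s n" "\<And>n. n \<ge> N \<Longrightarrow> e \<le> t n"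
proof -
  obtain e where e: "0 < ereal e" "ereal e < liminf (\<lambda>n. ereal (s n * t n))"
    using ereal_dense2[OF assms(1)] by blast
  then have "\<forall>\<^sub>F n in sequentially. ereal e < ereal (s n * t n)" using less_LiminfD by blast
  then obtain N where N: "\<And>n. n \<ge> N \<Longrightarrow> e < s n * t n" by (auto simp: eventually_sequentially)
  show ?thesis
  proof (rule that[of e "max 1 N"])
    fix n assume n: "n \<ge> max 1 N"
    then have st: "s n \<in> {0<..<1}" "t n \<in> {0<..<1}" using assms(2,3) by auto
    then have "s n * t n \<le> s n * 1" "s n * t n \<le> 1 * t n" by (intro mult_left_mono mult_right_mono; simp)+
    then show "e \<le> s n" "e \<le> t n" using N[of n] n by auto
  qed (use e in simp)
qed

section \<open>From the extended-real hypotheses to the real-valued setting\<close>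

lemma has_gateaux_gradient_unique:
  assumes "has_gateaux_gradient F l x" "has_gateaux_gradient F l' x"
  shows "l = l'"
proof (rule blinfun_eqI)
  fix y
  have "((\<lambda>t::real. (F (x + t *\<^sub>R y) - F x) / ereal t) \<longlongrightarrow> ereal (l y)) (at 0)"
    "((\<lambda>t::real. (F (x + t *\<^sub>R y) - F x) / ereal t) \<longlongrightarrow> ereal (l' y)) (at 0)"
    using assms unfolding has_gateaux_gradient_def by blast+
  then have "ereal (l y) = ereal (l' y)" by (rule tendsto_unique[OF trivial_limit_at])
  then show "l y = l' y" by simp
qed

lemma bregman_functionI:
  fixes f :: "'a::banach \<Rightarrow> real"
  assumes "admissible (\<lambda>x. ereal (f x))" "strongly_coercive f" "legendre (\<lambda>x. ereal (f x))"
    "bounded_on_bounded f" "uniformly_frechet_on_bounded f" "totally_convex_on_bounded f"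
  shows "bregman_function f"
proof
  show "convex_on UNIV f"
  proof (rule convex_onI)
    fix t :: real and x y assume t: "0 < t" "t < 1"
    have "ereal (f ((1 - t) *\<^sub>R x + t *\<^sub>R y)) \<le> ereal (1 - t) * ereal (f x) + ereal t * ereal (f y)"
      using assms(1) t unfolding admissible_def convex_ereal_def by auto
    then show "f ((1 - t) *\<^sub>R x + t *\<^sub>R y) \<le> (1 - t) * f x + t * f y" by simp
  qed simp
  fix x y
  have "eff_dom (\<lambda>x. ereal (f x)) = UNIV" by (simp add: eff_dom_def)
  then have "gateaux_differentiable (\<lambda>x. ereal (f x)) x"
    using assms(3) by (auto simp: legendre_def legendre_half_def)
  then have "has_gateaux_gradient (\<lambda>x. ereal (f x)) (grad f x) x"
    unfolding gateaux_differentiable_def gateaux_gradient_def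
    using has_gateaux_gradient_unique by (metis theI)
  then have "((\<lambda>t::real. (ereal (f (x + t *\<^sub>R y)) - ereal (f x)) / ereal t) \<longlongrightarrow> ereal (grad f x y)) (at 0)"
    unfolding has_gateaux_gradient_def by blast
  moreover have "\<forall>\<^sub>F t::real in at 0. (ereal (f (x + t *\<^sub>R y)) - ereal (f x)) / ereal t = ereal ((f (x + t *\<^sub>R y) - f x) / t)"
    unfolding eventually_at by (intro exI[of _ 1]) auto
  ultimately have "((\<lambda>t. ereal ((f (x + t *\<^sub>R y) - f x) / t)) \<longlongrightarrow> ereal (grad f x y)) (at 0)"
    by (rule Lim_transform_eventually)
  then show "((\<lambda>t. (f (x + t *\<^sub>R y) - f x) / t) \<longlongrightarrow> grad f x y) (at 0)" by (simp add: lim_ereal)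
qed (use assms in auto)

context bregman_function
begin

text \<open>Apply the three point identity through \<open>w\<close> to each \<open>x1\<close>, ...,
  \<open>x4\<close>; the linear terms cancel because \<open>G w\<close> is the weighted mean of the
  gradients. Shorter means are obtained with zero weights.\<close>

lemma D_combination:
  assumes w: "G w = c1 *\<^sub>R G x1 + c2 *\<^sub>R G x2 + c3 *\<^sub>R G x3 + c4 *\<^sub>R G x4" and c: "c1 + c2 + c3 + c4 = 1"
  shows "c1 * D p x1 + c2 * D p x2 + c3 * D p x3 + c4 * D p x4
    = D p w + (c1 * D w x1 + c2 * D w x2 + c3 * D w x3 + c4 * D w x4)"
proof -
  define E where "E x = G x (p - w)" for x
  have D: "D p x = D p w + D w x + (E w - E x)" for x
    using three_point[of p x w] by (simp add: E_def blinfun.diff_left)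
  have "E w = c1 * E x1 + c2 * E x2 + c3 * E x3 + c4 * E x4"
    unfolding E_def by (subst w) (simp add: blinfun.add_left blinfun.scaleR_left)
  then have "c1 * (E w - E x1) + c2 * (E w - E x2) + c3 * (E w - E x3) + c4 * (E w - E x4)
      = (c1 + c2 + c3 + c4) * E w - E w" by (simp add: algebra_simps)
  then have z: "c1 * (E w - E x1) + c2 * (E w - E x2) + c3 * (E w - E x3) + c4 * (E w - E x4) = 0"
    using c by simp
  have "c1 * D p x1 + c2 * D p x2 + c3 * D p x3 + c4 * D p x4 = (c1 + c2 + c3 + c4) * D p w
    + (c1 * D w x1 + c2 * D w x2 + c3 * D w x3 + c4 * D w x4)
    + (c1 * (E w - E x1) + c2 * (E w - E x2) + c3 * (E w - E x3) + c4 * (E w - E x4))"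
    unfolding D[of x1] D[of x2] D[of x3] D[of x4] by (simp add: algebra_simps)
  then show ?thesis using z c by simp
qed

text \<open>Nonexpansiveness towards a fixed point \<open>p\<close> reads
  \<open>D p (S y) \<le> D p y\<close>. It passes to limits and to convex combinations of such
  \<open>p\<close>, and at \<open>y = p\<close> it forces \<open>S p = p\<close>.\<close>

lemma fixed_points_closed_convex:
  assumes C: "closed C" "convex C" and S: "bregman_nonexpansive f C S"
  shows "closed (fixed_points C S)" "convex (fixed_points C S)"
proof -
  have le: "D p (S y) \<le> D p y" if "p \<in> fixed_points C S" "y \<in> C" for p y
    using S that unfolding bregman_nonexpansive_def fixed_points_def by force
  show "closed (fixed_points C S)"
    unfolding closed_sequential_limits
  proof (intro allI impI, elim conjE)
    fix s q assume s: "\<forall>n. s n \<in> fixed_points C S" and q: "s \<longlonglongrightarrow> q"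
    have qC: "q \<in> C" using C(1) s q unfolding closed_sequential_limits fixed_points_def by blast
    have lim: "(\<lambda>n. D (s n) y) \<longlonglongrightarrow> D q y" for y
      using D_continuous[of UNIV y] q by (auto simp: continuous_on_def intro: tendsto_compose continuous_on_tendsto_compose)
    have "D q (S q) \<le> D q q" by (rule LIMSEQ_le[OF lim lim]) (use le s qC in blast)
    then have "D q (S q) = 0" using D_nonneg[of q "S q"] by simp
    then show "q \<in> fixed_points C S" using qC by (simp add: fixed_points_def)
  qed
  show "convex (fixed_points C S)"
  proof (rule convexI)
    fix p1 p2 and u v :: real
    assume p: "p1 \<in> fixed_points C S" "p2 \<in> fixed_points C S" and uv: "0 \<le> u" "0 \<le> v" "u + v = 1"
    let ?q = "u *\<^sub>R p1 + v *\<^sub>R p2"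
    have qC: "?q \<in> C" using C(2) p uv by (auto simp: fixed_points_def intro: convexD)
    \<comment> \<open>In its first argument \<open>D\<close> is \<open>f\<close> plus an affine map,
      so the excess is independent of \<open>y\<close> and cancels between \<open>S ?q\<close> and
      \<open>?q\<close>.\<close>
    have split: "u * D p1 y + v * D p2 y = D ?q y + (u * f p1 + v * f p2 - f ?q)" for y
    proof -
      have v: "v = 1 - u" using uv by simp
      show ?thesis unfolding bregman_dist_def v by (simp add: blinfun.bilinear_simps algebra_simps)
    qed
    have "u * D p1 (S ?q) + v * D p2 (S ?q) \<le> u * D p1 ?q + v * D p2 ?q"
      using le p qC uv by (intro add_mono mult_left_mono) auto
    then have "D ?q (S ?q) \<le> D ?q ?q" unfolding split by simp
    then have "D ?q (S ?q) = 0" using D_nonneg[of ?q "S ?q"] by simp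
    then show "?q \<in> fixed_points C S" using qC by (simp add: fixed_points_def)
  qed
qed

text \<open>At a fixed point the gradient term vanishes, leaving \<open>0 \<le> \<phi> q y\<close>;
  monotonicity and Minty's argument make this equivalent to
  \<open>\<phi> y q \<le> 0\<close>.\<close>

lemma fixed_points_resolvent:
  assumes C: "C \<noteq> {}" "closed C" "convex C"
    and diag: "\<And>p. p \<in> C \<Longrightarrow> \<phi> p p = 0"
    and mono: "monotone_bifun C \<phi>"
    and hemi: "upper_hemicontinuous_bifun C \<phi>"
    and conv: "\<And>p. p \<in> C \<Longrightarrow> convex_on C (\<phi> p) \<and> lsc_on C (\<phi> p)"
  shows "fixed_points UNIV (resolvent f C \<phi>) = equilibrium_set C \<phi>"
proof -
  have res: "resolvent f C \<phi> x \<in> resolvent_set f C \<phi> x" for x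
    using resolvent_in[OF mono resolvent_set_nonempty[OF C diag mono hemi conv]] by blast
  have "resolvent f C \<phi> q = q \<longleftrightarrow> q \<in> resolvent_set f C \<phi> q" for q
    using res resolvent_set_unique[OF mono] by metis
  moreover have "q \<in> resolvent_set f C \<phi> q \<longleftrightarrow> q \<in> C \<and> (\<forall>y\<in>C. 0 \<le> \<phi> q y)" for q
    by (simp add: resolvent_set_def)
  moreover have "q \<in> C \<and> (\<forall>y\<in>C. 0 \<le> \<phi> q y) \<longleftrightarrow> q \<in> equilibrium_set C \<phi>" for q
  proof
    assume q: "q \<in> C \<and> (\<forall>y\<in>C. 0 \<le> \<phi> q y)"
    show "q \<in> equilibrium_set C \<phi>" unfolding equilibrium_set_def
    proof (intro CollectI conjI ballI)
      fix y assume "y \<in> C"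
      then have "\<phi> y q + \<phi> q y \<le> 0" "0 \<le> \<phi> q y" using mono q by (auto simp: monotone_bifun_def)
      then show "\<phi> y q \<le> 0" by linarith
    qed (use q in blast)
  next
    assume q: "q \<in> equilibrium_set C \<phi>"
    then have "q \<in> C" by (simp add: equilibrium_set_def)
    moreover have "0 \<le> \<phi> q y" if "y \<in> C" for y
      using conv by (intro equilibrium_set_nonneg[OF C(3) diag hemi _ q that]) auto
    ultimately show "q \<in> C \<and> (\<forall>y\<in>C. 0 \<le> \<phi> q y)" by blast
  qed
  ultimately show ?thesis by (auto simp: fixed_points_def)
qed

text \<open>Up to a constant the objective is \<open>f\<close> plus the convex function
  \<open>Q\<close>. As \<open>arg_min_on\<close> is a choice operator, a minimizer has to be
  exhibited before \<open>m\<close> is known to be one.\<close>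

lemma arg_min_prox:
  assumes C: "C \<noteq> {}" "closed C" and q: "convex_on C q" "lsc_on C q" and c: "c > 0"
    and m: "m = arg_min_on (\<lambda>y. c * q y + D y x) C"
  shows "m \<in> C" "y \<in> C \<Longrightarrow> 0 \<le> c * (q y - q m) + (G m - G x) (y - m)"
proof -
  define Q where "Q y = - G x y + c * q y" for y
  have cQ: "convex_on C Q"
  proof -
    have "convex_on C (\<lambda>y. - G x y)"
      using convex_on_imp_convex[OF q(1)]
      by (intro convex_onI) (auto simp: blinfun.bilinear_simps algebra_simps)
    from convex_on_add[OF this convex_on_cmul[of c, OF _ q(1)]] c show ?thesis by (simp add: Q_def[abs_def])
  qed
  have lQ: "lsc_on C Q"
    unfolding Q_def[abs_def] by (intro lsc_on_add_continuous lsc_on_cmult c q continuous_intros)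
  obtain m0 where m0: "m0 \<in> C" "\<And>y. y \<in> C \<Longrightarrow> f m0 + Q m0 \<le> f y + Q y"
    using convex_minimizer_exists[OF C cQ lQ] by blast
  have obj: "c * q y + D y x = f y + Q y + (G x x - f x)" for y
    by (simp add: Q_def bregman_dist_def blinfun.diff_right)
  have "is_arg_min (\<lambda>y. c * q y + D y x) (\<lambda>y. y \<in> C) m0"
    using m0 unfolding is_arg_min_linorder obj by simp
  then have "is_arg_min (\<lambda>y. c * q y + D y x) (\<lambda>y. y \<in> C) m"
    unfolding m arg_min_on_def arg_min_def by (rule someI)
  then have m': "m \<in> C" "\<And>y. y \<in> C \<Longrightarrow> f m + Q m \<le> f y + Q y"
    unfolding is_arg_min_linorder obj by auto
  then show "m \<in> C" by simp
  show "0 \<le> c * (q y - q m) + (G m - G x) (y - m)" if "y \<in> C"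
    using minimizer_optimality[OF cQ m' that] by (simp add: Q_def blinfun.bilinear_simps algebra_simps)
qed

text \<open>The optimality condition for \<open>y\<close> is tested at \<open>z\<close>, the one for \<open>z\<close> at \<open>p\<close>.\<close>

lemma extragradient_estimate:
  assumes lip: "bregman_lipschitz f C g c1 c2"
    and C: "x \<in> C" "y \<in> C" "z \<in> C" "p \<in> equilibrium_set C g" and c: "c > 0"
    and y: "\<And>q. q \<in> C \<Longrightarrow> 0 \<le> c * (g x q - g x y) + (G y - G x) (q - y)"
    and z: "\<And>q. q \<in> C \<Longrightarrow> 0 \<le> c * (g y q - g y z) + (G z - G x) (q - z)"
  shows "D p z + (1 - c * c1) * D y x + (1 - c * c2) * D z y \<le> D p x"
proof -
  have p: "p \<in> C" "g y p \<le> 0" using C by (auto simp: equilibrium_set_def)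
  have "g x z - c1 * D y x - c2 * D z y \<le> g x y + g y z"
    using lip C unfolding bregman_lipschitz_def by blast
  then have "c * (g x z - c1 * D y x - c2 * D z y) \<le> c * (g x y + g y z)" using c by (intro mult_left_mono) auto
  then have 1: "c * (g x z - g x y) - c * c1 * D y x - c * c2 * D z y \<le> c * g y z" by (simp add: algebra_simps)
  have "c * g y p \<le> 0" using p c by (simp add: mult_nonneg_nonpos)
  then have 2: "c * g y z \<le> (G z - G x) (p - z)" using z[OF p(1)] by (simp add: algebra_simps)
  have 3: "0 \<le> c * (g x z - g x y) + (G y - G x) (z - y)" using y[OF C(3)] .
  have "(G y - G x) (z - y) = D z x - D z y - D y x" using three_point[of z x y] by simp
  moreover have "(G z - G x) (p - z) = D p x - D p z - D z x" using three_point[of p x z] by simp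
  ultimately show ?thesis using 1 2 3 by (simp add: algebra_simps)
qed

end

theorem theorem3p1:
  fixes C :: "'a::banach set"
    and f :: "'a \<Rightarrow> real"
    and g \<phi> :: "'a \<Rightarrow> 'a \<Rightarrow> real"
    and S :: "'a \<Rightarrow> 'a"
    and \<Omega> :: "'a set"
    and u :: 'a
    and x y z v w us k h :: "nat \<Rightarrow> 'a"
    and \<alpha> \<gamma> :: "nat \<Rightarrow> nat \<Rightarrow> real"
    and \<beta> \<delta> lam :: "nat \<Rightarrow> real"
    and a b c1 c2 :: real
  assumes "reflexive_space TYPE('a)"
    and "C \<noteq> {}" "closed C" "convex C"
    and "admissible (\<lambda>x. ereal (f x))"
    and "strongly_coercive f"
    and "legendre (\<lambda>x. ereal (f x))"
    and "bounded_on_bounded f"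
    and "uniformly_frechet_on_bounded f"
    and "totally_convex_on_bounded f"
    and g_diag: "\<And>p. p \<in> C \<Longrightarrow> g p p = 0"
    and A1: "monotone_bifun C g"
    and A2: "pseudomonotone_bifun C g"
    and A3: "bregman_lipschitz f C g c1 c2"
    and A4: "weakly_continuous_bifun C g"
    and A5: "\<And>p. p \<in> C \<Longrightarrow> convex_on C (g p) \<and> lsc_on C (g p) \<and> subdifferentiable_on C (g p)"
    and "bregman_nonexpansive f C S"
    and "asymptotic_fixed_points C S = fixed_points C S"
    and B1: "\<And>p. p \<in> C \<Longrightarrow> \<phi> p p = 0"
    and B2: "monotone_bifun C \<phi>"
    and B3: "upper_hemicontinuous_bifun C \<phi>"
    and B4: "\<And>p. p \<in> C \<Longrightarrow> convex_on C (\<phi> p) \<and> lsc_on C (\<phi> p)"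
    and \<Omega>: "\<Omega> = fixed_points C S \<inter> equilibrium_set C g \<inter> fixed_points UNIV (resolvent f C \<phi>)"
    and "\<Omega> \<noteq> {}"
    and x1: "x 1 \<in> C"
    and y: "\<And>n. n \<ge> 1 \<Longrightarrow>
      y n = arg_min_on (\<lambda>q. lam n * g (x n) q + bregman_dist f q (x n)) C"
    and z: "\<And>n. n \<ge> 1 \<Longrightarrow>
      z n = arg_min_on (\<lambda>q. lam n * g (y n) q + bregman_dist f q (x n)) C"
    and v: "\<And>n. n \<ge> 1 \<Longrightarrow>
      v n = grad_conj f (\<delta> n *\<^sub>R grad f (resolvent f C \<phi> (x n))
                         + (1 - \<delta> n) *\<^sub>R grad f (resolvent f C \<phi> (z n)))"
    and w: "\<And>n. n \<ge> 1 \<Longrightarrow>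
      w n = grad_conj f (\<gamma> n 1 *\<^sub>R grad f (v n) + \<gamma> n 2 *\<^sub>R grad f (z n)
                         + \<gamma> n 3 *\<^sub>R grad f (S (z n)))"
    and w_in_C: "\<And>n. n \<ge> 1 \<Longrightarrow> w n \<in> C"
    and us: "\<And>n. n \<ge> 1 \<Longrightarrow>
      us n \<in> C \<and>
      (\<forall>q\<in>C. \<phi> (us n) q + blinfun_apply (grad f (us n) - grad f (w n)) (q - us n) \<ge> 0)"
    and k: "\<And>n. n \<ge> 1 \<Longrightarrow>
      k n = grad_conj f (\<beta> n *\<^sub>R grad f (w n) + (1 - \<beta> n) *\<^sub>R grad f (S (w n)))"
    and h: "\<And>n. n \<ge> 1 \<Longrightarrow>
      h n = grad_conj f (\<alpha> n 1 *\<^sub>R grad f u + \<alpha> n 2 *\<^sub>R grad f (x n)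
                         + \<alpha> n 3 *\<^sub>R grad f (us n) + \<alpha> n 4 *\<^sub>R grad f (k n))"
    and x_step: "\<And>n. n \<ge> 1 \<Longrightarrow> x (Suc n) = bregman_proj f C (h n)"
    and \<delta>: "\<And>n. n \<ge> 1 \<Longrightarrow> \<delta> n \<in> {0<..<1}"
    and \<alpha>_range: "\<And>n i. n \<ge> 1 \<Longrightarrow> i \<in> {1..4} \<Longrightarrow> \<alpha> n i \<in> {0<..<1}"
    and \<alpha>_sum: "\<And>n. n \<ge> 1 \<Longrightarrow> (\<Sum>i=1..4. \<alpha> n i) = 1"
    and \<alpha>1_lim: "(\<lambda>n. \<alpha> n 1) \<longlonglongrightarrow> 0"
    and \<alpha>1_div: "filterlim (\<lambda>N. \<Sum>n=1..N. \<alpha> n 1) at_top sequentially"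
    and \<alpha>_liminf: "\<And>i j. i \<in> {2..3} \<Longrightarrow> j \<in> {2..3} \<Longrightarrow> i \<noteq> j \<Longrightarrow>
      liminf (\<lambda>n. ereal (\<alpha> n i * \<alpha> n j)) > 0"
    and \<gamma>_range: "\<And>n i. n \<ge> 1 \<Longrightarrow> i \<in> {1..3} \<Longrightarrow> \<gamma> n i \<in> {0<..<1}"
    and \<gamma>_sum: "\<And>n. n \<ge> 1 \<Longrightarrow> \<gamma> n 1 + \<gamma> n 2 + \<gamma> n 3 = 1"
    and \<gamma>_liminf: "\<And>i j. i \<in> {1..3} \<Longrightarrow> j \<in> {1..3} \<Longrightarrow> i \<noteq> j \<Longrightarrow>
      liminf (\<lambda>n. ereal (\<gamma> n i * \<gamma> n j)) > 0"
    and lam_range: "\<And>n. n \<ge> 1 \<Longrightarrow> lam n \<in> {a..b}"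
    and ab: "{a..b} \<subseteq> {0<..<min (1 / c1) (1 / c2)}"
    and \<beta>_range: "\<And>n. n \<ge> 1 \<Longrightarrow> \<beta> n \<in> {0<..<1}"
    and \<beta>_liminf: "liminf (\<lambda>n. ereal (\<beta> n * (1 - \<beta> n))) > 0"
  shows "x \<longlonglongrightarrow> bregman_proj f \<Omega> u"
proof -

  \<comment> \<open>The solution set and the candidate limit\<close>
  interpret bregman_function f using assms(5-10) by (intro bregman_functionI)
  note C = assms(2-4) and S_ne = \<open>bregman_nonexpansive f C S\<close>
  note G_conj = grad_grad_conj[OF assms(7)]
  have \<phi>_res: "resolvent f C \<phi> q \<in> resolvent_set f C \<phi> q" for q
    using resolvent_in[OF B2 resolvent_set_nonempty[OF C B1 B2 B3 B4]] by blast
  have \<Omega>': "\<Omega> = fixed_points C S \<inter> equilibrium_set C g \<inter> equilibrium_set C \<phi>"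
    using fixed_points_resolvent[OF C B1 B2 B3 B4] \<Omega> by simp
  have \<Omega>_cc: "closed \<Omega>" "convex \<Omega>"
    unfolding \<Omega>' using A5 B4
    by (intro closed_Int convex_Int fixed_points_closed_convex[OF C(2,3) S_ne]
        equilibrium_set_closed_convex C(2,3); blast)+
  define p where "p = bregman_proj f \<Omega> u"
  have p\<Omega>: "p \<in> \<Omega>" unfolding p_def using \<open>\<Omega> \<noteq> {}\<close> \<Omega>_cc by (rule bregman_proj_in)
  have p_vi: "0 \<le> (G p - G u) (q - p)" if "q \<in> \<Omega>" for q
    unfolding p_def using \<open>\<Omega> \<noteq> {}\<close> \<Omega>_cc that by (rule bregman_proj_variational)
  have pC: "p \<in> C" and pS: "S p = p" and pg: "p \<in> equilibrium_set C g" and p\<phi>: "p \<in> equilibrium_set C \<phi>"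
    using p\<Omega> unfolding \<Omega>' by (auto simp: fixed_points_def)
  have p\<phi>': "0 \<le> \<phi> p q" if "q \<in> C" for q
    using B4 by (intro equilibrium_set_nonneg[OF C(3) B1 B3 _ p\<phi> that]) auto
  have SC: "S q \<in> C" if "q \<in> C" for q using S_ne that by (auto simp: bregman_nonexpansive_def)
  have S_le: "D p (S q) \<le> D p q" if "q \<in> C" for q
    using S_ne pC that unfolding bregman_nonexpansive_def by (metis pS)
  have res_le: "D p q' + D q' q \<le> D p q" if "q' \<in> resolvent_set f C \<phi> q" for q q'
    by (rule resolvent_set_D_le[OF B2 that pC p\<phi>'])
  have res_le': "D p (resolvent f C \<phi> q) \<le> D p q" for q
    using res_le[OF \<phi>_res[of q]] D_nonneg[of "resolvent f C \<phi> q" q] by linarith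
  have xC: "x n \<in> C" if "n \<ge> 1" for n
    using that
  proof (induction n rule: nat_induct_at_least)
    case (Suc n)
    then show ?case using x_step[of n] bregman_proj_in[OF C] by simp
  qed (rule x1)

  \<comment> \<open>Step sizes and optimality of the two proximal steps\<close>
  have "c1 > 0" "c2 > 0" using A3 by (auto simp: bregman_lipschitz_def)
  \<comment> \<open>The interval is thus nonempty, so its endpoints belong to it and inherit the
    strict bounds in \<open>ab\<close>.\<close>
  have "lam 1 \<in> {a..b}" using lam_range by simp
  then have "a \<in> {a..b}" "b \<in> {a..b}" by auto
  then have a_pos: "0 < a" and "b < 1 / c1" "b < 1 / c2" using ab by (auto simp: subset_iff)
  then have bc: "b * c1 < 1" "b * c2 < 1" using \<open>c1 > 0\<close> \<open>c2 > 0\<close> by (simp_all add: field_simps)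
  have lam_pos: "0 < lam n" and lam_c1: "1 - b * c1 \<le> 1 - lam n * c1" and lam_c2: "0 \<le> 1 - lam n * c2"
    if "n \<ge> 1" for n
  proof -
    have l: "a \<le> lam n" "lam n \<le> b" using lam_range[OF that] by auto
    then show "0 < lam n" using a_pos by simp
    have "lam n * c1 \<le> b * c1" "lam n * c2 \<le> b * c2" using l \<open>c1 > 0\<close> \<open>c2 > 0\<close> by (simp_all add: mult_right_mono)
    then show "1 - b * c1 \<le> 1 - lam n * c1" "0 \<le> 1 - lam n * c2" using bc by auto
  qed
  have yC: "y n \<in> C" and y_opt: "\<And>q. q \<in> C \<Longrightarrow> 0 \<le> lam n * (g (x n) q - g (x n) (y n)) + (G (y n) - G (x n)) (q - y n)"
    if "n \<ge> 1" for n
    using arg_min_prox[OF C(1,2) _ _ lam_pos[OF that] y[OF that]] A5[OF xC[OF that]] by blast+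
  have zC: "z n \<in> C" and z_opt: "\<And>q. q \<in> C \<Longrightarrow> 0 \<le> lam n * (g (y n) q - g (y n) (z n)) + (G (z n) - G (x n)) (q - z n)"
    if "n \<ge> 1" for n
    using arg_min_prox[OF C(1,2) _ _ lam_pos[OF that] z[OF that]] A5[OF yC[OF that]] by blast+

  \<comment> \<open>Decrease of the distance to \<open>p\<close> in each averaging step\<close>
  have z_le: "D p (z n) + (1 - b * c1) * D (y n) (x n) \<le> D p (x n)" if n: "n \<ge> 1" for n
  proof -
    have "D p (z n) + (1 - lam n * c1) * D (y n) (x n) + (1 - lam n * c2) * D (z n) (y n) \<le> D p (x n)"
      by (rule extragradient_estimate[OF A3 xC[OF n] yC[OF n] zC[OF n] pg lam_pos[OF n] y_opt[OF n] z_opt[OF n]])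
    moreover have "(1 - b * c1) * D (y n) (x n) \<le> (1 - lam n * c1) * D (y n) (x n)"
      using lam_c1[OF n] by (intro mult_right_mono) auto
    moreover have "0 \<le> (1 - lam n * c2) * D (z n) (y n)" using lam_c2[OF n] by simp
    ultimately show ?thesis by linarith
  qed
  have z_le': "D p (z n) \<le> D p (x n)" if n: "n \<ge> 1" for n
  proof -
    have "0 \<le> (1 - b * c1) * D (y n) (x n)" using bc by simp
    then show ?thesis using z_le[OF n] by linarith
  qed
  have v_le: "D p (v n) \<le> D p (x n)" if n: "n \<ge> 1" for n
  proof -
    let ?a = "resolvent f C \<phi> (x n)" and ?b = "resolvent f C \<phi> (z n)"
    have d: "0 \<le> \<delta> n" "0 \<le> 1 - \<delta> n" using \<delta>[OF n] by auto
    have "\<delta> n * D p ?a + (1 - \<delta> n) * D p ?b = D p (v n) + (\<delta> n * D (v n) ?a + (1 - \<delta> n) * D (v n) ?b)"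
      using D_combination[of "v n" "\<delta> n" ?a "1 - \<delta> n" ?b 0 ?a 0 ?a p] by (simp add: v[OF n] G_conj)
    moreover have "0 \<le> \<delta> n * D (v n) ?a + (1 - \<delta> n) * D (v n) ?b" using d by simp
    moreover have "D p ?b \<le> D p (x n)" using res_le'[of "z n"] z_le'[OF n] by linarith
    then have "\<delta> n * D p ?a + (1 - \<delta> n) * D p ?b \<le> \<delta> n * D p (x n) + (1 - \<delta> n) * D p (x n)"
      using d res_le'[of "x n"] by (intro add_mono mult_left_mono) auto
    ultimately show ?thesis by (simp add: algebra_simps)
  qed
  \<comment> \<open>The extragradient loss is carried along with weight \<open>\<gamma> n 2\<close>;
    it is what later forces \<open>y n - x n\<close> to 0.\<close>
  have w_le: "D p (w n) + \<gamma> n 2 * D (w n) (z n) + \<gamma> n 3 * D (w n) (S (z n))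
      + \<gamma> n 2 * ((1 - b * c1) * D (y n) (x n)) \<le> D p (x n)" if n: "n \<ge> 1" for n
  proof -
    have \<gamma>: "0 \<le> \<gamma> n 1" "0 \<le> \<gamma> n 2" "0 \<le> \<gamma> n 3"
      using \<gamma>_range[OF n, of 1] \<gamma>_range[OF n, of 2] \<gamma>_range[OF n, of 3] by auto
    have "\<gamma> n 1 * D p (v n) + \<gamma> n 2 * D p (z n) + \<gamma> n 3 * D p (S (z n)) = D p (w n)
        + (\<gamma> n 1 * D (w n) (v n) + \<gamma> n 2 * D (w n) (z n) + \<gamma> n 3 * D (w n) (S (z n)))"
      using D_combination[of "w n" "\<gamma> n 1" "v n" "\<gamma> n 2" "z n" "\<gamma> n 3" "S (z n)" 0 "z n" p] \<gamma>_sum[OF n]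
      by (simp add: w[OF n] G_conj)
    moreover have "0 \<le> \<gamma> n 1 * D (w n) (v n)" using \<gamma> by simp
    moreover have "\<gamma> n 1 * D p (v n) \<le> \<gamma> n 1 * D p (x n)" using \<gamma> v_le[OF n] by (intro mult_left_mono)
    moreover have "\<gamma> n 2 * D p (z n) \<le> \<gamma> n 2 * (D p (x n) - (1 - b * c1) * D (y n) (x n))"
      using \<gamma> z_le[OF n] by (intro mult_left_mono) auto
    moreover have "\<gamma> n 3 * D p (S (z n)) \<le> \<gamma> n 3 * D p (x n)"
      using \<gamma> S_le[OF zC[OF n]] z_le'[OF n] by (intro mult_left_mono) auto
    moreover have "\<gamma> n 1 * D p (x n) + \<gamma> n 2 * D p (x n) + \<gamma> n 3 * D p (x n) = D p (x n)"
      using \<gamma>_sum[OF n] by (simp flip: distrib_right)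
    ultimately show ?thesis unfolding right_diff_distrib by linarith
  qed
  have w_le': "D p (w n) \<le> D p (x n)" if n: "n \<ge> 1" for n
  proof -
    have "0 \<le> \<gamma> n 2" "0 \<le> \<gamma> n 3" using \<gamma>_range[OF n, of 2] \<gamma>_range[OF n, of 3] by auto
    then have "0 \<le> \<gamma> n 2 * D (w n) (z n)" "0 \<le> \<gamma> n 3 * D (w n) (S (z n))"
      "0 \<le> \<gamma> n 2 * ((1 - b * c1) * D (y n) (x n))" using bc by auto
    then show ?thesis using w_le[OF n] by linarith
  qed
  have us_le: "D p (us n) + D (us n) (w n) \<le> D p (w n)" if n: "n \<ge> 1" for n
    using us[OF n] by (intro res_le) (simp add: resolvent_set_def)
  have us_le': "D p (us n) \<le> D p (x n)" if n: "n \<ge> 1" for n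
    using us_le[OF n] w_le'[OF n] D_nonneg[of "us n" "w n"] by linarith
  have k_le: "D p (k n) \<le> D p (x n)" if n: "n \<ge> 1" for n
  proof -
    have d: "0 \<le> \<beta> n" "0 \<le> 1 - \<beta> n" using \<beta>_range[OF n] by auto
    have "\<beta> n * D p (w n) + (1 - \<beta> n) * D p (S (w n))
        = D p (k n) + (\<beta> n * D (k n) (w n) + (1 - \<beta> n) * D (k n) (S (w n)))"
      using D_combination[of "k n" "\<beta> n" "w n" "1 - \<beta> n" "S (w n)" 0 "w n" 0 "w n" p] by (simp add: k[OF n] G_conj)
    moreover have "0 \<le> \<beta> n * D (k n) (w n) + (1 - \<beta> n) * D (k n) (S (w n))" using d by simp
    moreover have "D p (S (w n)) \<le> D p (x n)" using S_le[OF w_in_C[OF n]] w_le'[OF n] by linarith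
    then have "\<beta> n * D p (w n) + (1 - \<beta> n) * D p (S (w n)) \<le> \<beta> n * D p (x n) + (1 - \<beta> n) * D p (x n)"
      using d w_le'[OF n] by (intro add_mono mult_left_mono) auto
    ultimately show ?thesis by (simp add: algebra_simps)
  qed

  \<comment> \<open>The recursion for the distance to \<open>p\<close>\<close>
  define gap where "gap n = \<alpha> n 2 * D (h n) (x n) + \<alpha> n 3 * D (h n) (us n) + \<alpha> n 3 * (D p (x n) - D p (us n))" for n
  define bb where "bb n = (G u - G p) (h n - p)" for n
  have \<alpha>_pos: "0 < \<alpha> n 1" "\<alpha> n 1 < 1" "0 < \<alpha> n 2" "0 < \<alpha> n 3" "0 < \<alpha> n 4" if n: "n \<ge> 1" for n
    using \<alpha>_range[OF n, of 1] \<alpha>_range[OF n, of 2] \<alpha>_range[OF n, of 3] \<alpha>_range[OF n, of 4] by auto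
  have \<alpha>_sum': "\<alpha> n 1 + \<alpha> n 2 + \<alpha> n 3 + \<alpha> n 4 = 1" if n: "n \<ge> 1" for n
    using \<alpha>_sum[OF n] by (simp add: numeral_eq_Suc)
  have h_id: "\<alpha> n 1 * D p u + \<alpha> n 2 * D p (x n) + \<alpha> n 3 * D p (us n) + \<alpha> n 4 * D p (k n) = D p (h n)
      + (\<alpha> n 1 * D (h n) u + \<alpha> n 2 * D (h n) (x n) + \<alpha> n 3 * D (h n) (us n) + \<alpha> n 4 * D (h n) (k n))"
    if n: "n \<ge> 1" for n
    using \<alpha>_sum'[OF n] by (intro D_combination) (simp_all add: h[OF n] G_conj)
  \<comment> \<open>The last term of \<open>gap\<close>, the drop in distance from
    \<open>x n\<close> to \<open>us n\<close>, dominates the losses on the way to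
    \<open>us n\<close>; the first two compare \<open>h n\<close> with \<open>x n\<close> and
    \<open>us n\<close>.\<close>
  have gap_nonneg: "0 \<le> gap n" if n: "n \<ge> 1" for n
    unfolding gap_def using \<alpha>_pos[OF n] us_le'[OF n] by simp
  have k_term: "\<alpha> n 4 * D p (k n) \<le> \<alpha> n 4 * D p (x n)" if n: "n \<ge> 1" for n
    using \<alpha>_pos[OF n] k_le[OF n] by (intro mult_left_mono) auto
  have proj_le: "D p (x (Suc n)) \<le> D p (h n)" if n: "n \<ge> 1" for n
    unfolding x_step[OF n]
    using bregman_proj_pythagoras[OF C pC, of "h n"] D_nonneg[of "bregman_proj f C (h n)" "h n"] by linarith
  have step: "D p (x (Suc n)) \<le> (1 - \<alpha> n 1) * D p (x n) + \<alpha> n 1 * bb n - gap n" if n: "n \<ge> 1" for n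
  proof -
    have "D p u - D (h n) u \<le> bb n"
      using three_point[of "h n" u p] D_nonneg[of "h n" p] by (simp add: bb_def blinfun.diff_left)
    then have "\<alpha> n 1 * (D p u - D (h n) u) \<le> \<alpha> n 1 * bb n" using \<alpha>_pos[OF n] by (intro mult_left_mono) auto
    moreover have "0 \<le> \<alpha> n 4 * D (h n) (k n)" using \<alpha>_pos[OF n] by simp
    moreover have "(1 - \<alpha> n 1) * D p (x n) = \<alpha> n 2 * D p (x n) + \<alpha> n 3 * D p (x n) + \<alpha> n 4 * D p (x n)"
      using \<alpha>_sum'[OF n] by (simp flip: distrib_right)
    ultimately show ?thesis
      using proj_le[OF n] h_id[OF n] k_term[OF n] unfolding gap_def right_diff_distrib by linarith
  qed

  \<comment> \<open>Boundedness of the iterates\<close>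
  define M where "M = max (D p (x 1)) (D p u)"
  have h_le: "D p (h n) \<le> M" if n: "n \<ge> 1" and xM: "D p (x n) \<le> M" for n
  proof -
    have "0 \<le> \<alpha> n 1 * D (h n) u + \<alpha> n 2 * D (h n) (x n) + \<alpha> n 3 * D (h n) (us n) + \<alpha> n 4 * D (h n) (k n)"
      using \<alpha>_pos[OF n] by simp
    moreover have "\<alpha> n 1 * D p u + \<alpha> n 2 * D p (x n) + \<alpha> n 3 * D p (us n) + \<alpha> n 4 * D p (k n)
        \<le> \<alpha> n 1 * M + \<alpha> n 2 * M + \<alpha> n 3 * M + \<alpha> n 4 * M"
      using \<alpha>_pos[OF n] xM us_le'[OF n] k_le[OF n]
      by (intro add_mono mult_left_mono) (auto simp: M_def)
    moreover have "\<alpha> n 1 * M + \<alpha> n 2 * M + \<alpha> n 3 * M + \<alpha> n 4 * M = M"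
      using \<alpha>_sum'[OF n] by (simp flip: distrib_right)
    ultimately show ?thesis using h_id[OF n] by linarith
  qed
  have x_M: "D p (x n) \<le> M" if "n \<ge> 1" for n
    using that
  proof (induction n rule: nat_induct_at_least)
    case (Suc n)
    then show ?case using proj_le[of n] h_le[of n] by linarith
  qed (simp add: M_def)
  define Bd where "Bd = {q. D p q \<le> M}"
  have Bd: "bounded Bd" unfolding Bd_def by (rule D_sublevel_bounded)
  have in_Bd: "x n \<in> Bd" "h n \<in> Bd" "us n \<in> Bd" "w n \<in> Bd" "z n \<in> Bd" "S (z n) \<in> Bd" if n: "n \<ge> 1" for n
    using x_M[OF n] h_le[OF n x_M[OF n]] us_le'[OF n] w_le'[OF n] z_le'[OF n] S_le[OF zC[OF n]]
    by (auto simp: Bd_def)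
  obtain R where R: "\<And>q. q \<in> Bd \<Longrightarrow> norm q \<le> R" using Bd by (auto simp: bounded_iff)
  have bb_le: "bb n \<le> norm (G u - G p) * (R + norm p)" if n: "n \<ge> 1" for n
  proof -
    have "bb n \<le> norm (G u - G p) * norm (h n - p)"
      unfolding bb_def using norm_blinfun[of "G u - G p" "h n - p"] by simp
    also have "\<dots> \<le> norm (G u - G p) * (R + norm p)"
      using norm_triangle_ineq4[of "h n" p] R[OF in_Bd(2)[OF n]] by (intro mult_left_mono) auto
    finally show ?thesis .
  qed

  obtain e1 N1 where e1: "e1 > 0" "\<And>n. n \<ge> N1 \<Longrightarrow> e1 \<le> \<alpha> n 2" "\<And>n. n \<ge> N1 \<Longrightarrow> e1 \<le> \<alpha> n 3"
    using liminf_product_pos[OF \<alpha>_liminf[of 2 3] \<alpha>_range[of _ 2] \<alpha>_range[of _ 3]] by auto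
  obtain e2 N2 where e2: "e2 > 0" "\<And>n. n \<ge> N2 \<Longrightarrow> e2 \<le> \<gamma> n 2" "\<And>n. n \<ge> N2 \<Longrightarrow> e2 \<le> \<gamma> n 3"
    using liminf_product_pos[OF \<gamma>_liminf[of 2 3] \<gamma>_range[of _ 2] \<gamma>_range[of _ 3]] by auto

  \<comment> \<open>Subsequences along which the gap vanishes\<close>
  have gap_forces: "\<exists>\<epsilon>>0. \<exists>N. \<forall>n\<ge>N. c < bb n \<longrightarrow> \<epsilon> \<le> gap n" if c: "c > 0" for c
  proof (rule ccontr)
    assume neg: "\<not> ?thesis"
    \<comment> \<open>The offset puts every index beyond 0, \<open>N1\<close> and \<open>N2\<close>.
      The indices \<open>m j\<close> need not increase strictly: the argument uses that
      \<open>gap (m j)\<close> tends to 0.\<close>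
    have "\<exists>n\<ge>Suc (j + N1 + N2). c < bb n \<and> gap n < inverse (real (Suc j))" for j
    proof -
      have "0 < inverse (real (Suc j))" by simp
      then show ?thesis using neg by (meson not_le)
    qed
    then obtain m where m: "\<And>j. m j \<ge> Suc (j + N1 + N2)" "\<And>j. c < bb (m j)" "\<And>j. gap (m j) < inverse (real (Suc j))"
      by metis
    have m1: "m j \<ge> 1" "m j \<ge> N1" "m j \<ge> N2" for j using m(1)[of j] by auto
    have gap0: "(\<lambda>j. gap (m j)) \<longlonglongrightarrow> 0"
      by (rule tendsto_sandwich[OF _ _ tendsto_const LIMSEQ_inverse_real_of_nat])
        (use gap_nonneg m1 m(3) in \<open>auto intro!: always_eventually less_imp_le\<close>)
    have "bounded (range (\<lambda>j. x (m j)))" using Bd by (rule bounded_subset) (use in_Bd m1 in auto)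
    then obtain r q where r: "strict_mono r" and q: "weakly_tendsto ((\<lambda>j. x (m j)) \<circ> r) q"
      using weakly_convergent_subsequence[OF assms(1)] by blast
    define i where "i j = m (r j)" for j
    have i: "i j \<ge> 1" "i j \<ge> N1" "i j \<ge> N2" for j using m1 by (auto simp: i_def)
    have xq: "weakly_tendsto (\<lambda>j. x (i j)) q" using q by (simp add: o_def i_def)
    have gap0: "(\<lambda>j. gap (i j)) \<longlonglongrightarrow> 0" using LIMSEQ_subseq_LIMSEQ[OF gap0 r] by (simp add: o_def i_def)

    \<comment> \<open>Norm closeness of the iterates\<close>
    have gap_terms: "e1 * D (h n) (x n) \<le> gap n" "e1 * D (h n) (us n) \<le> gap n" "e1 * (D p (x n) - D p (us n)) \<le> gap n"
      if n: "n \<ge> 1" "n \<ge> N1" for n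
    proof -
      have "e1 * D (h n) (x n) \<le> \<alpha> n 2 * D (h n) (x n)" "e1 * D (h n) (us n) \<le> \<alpha> n 3 * D (h n) (us n)"
        "e1 * (D p (x n) - D p (us n)) \<le> \<alpha> n 3 * (D p (x n) - D p (us n))"
        using e1 n us_le'[OF n(1)] by (auto intro!: mult_right_mono)
      moreover have "0 \<le> e1 * D (h n) (x n)" "0 \<le> e1 * D (h n) (us n)" "0 \<le> e1 * (D p (x n) - D p (us n))"
        using e1(1) us_le'[OF n(1)] by auto
      ultimately show "e1 * D (h n) (x n) \<le> gap n" "e1 * D (h n) (us n) \<le> gap n" "e1 * (D p (x n) - D p (us n)) \<le> gap n"
        unfolding gap_def by linarith+
    qed
    have P0: "(\<lambda>j. D p (x (i j)) - D p (us (i j))) \<longlonglongrightarrow> 0"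
      using us_le' gap_terms(3) i by (intro squeeze_to_0[OF _ _ e1(1) gap0]) auto
    define \<kappa> where "\<kappa> = 1 - b * c1"
    have \<kappa>: "\<kappa> > 0" using bc by (simp add: \<kappa>_def)
    \<comment> \<open>Chaining \<open>us_le\<close> and \<open>w_le\<close>, every loss between
      \<open>x n\<close> and \<open>us n\<close> is paid out of the same difference, which vanishes
      by \<open>P0\<close>.\<close>
    have P_terms: "1 * D (us n) (w n) \<le> D p (x n) - D p (us n)" "e2 * D (w n) (z n) \<le> D p (x n) - D p (us n)"
      "e2 * D (w n) (S (z n)) \<le> D p (x n) - D p (us n)" "(e2 * \<kappa>) * D (y n) (x n) \<le> D p (x n) - D p (us n)"
      if n: "n \<ge> 1" "n \<ge> N2" for n
    proof -
      have "e2 * D (w n) (z n) \<le> \<gamma> n 2 * D (w n) (z n)" "e2 * D (w n) (S (z n)) \<le> \<gamma> n 3 * D (w n) (S (z n))"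
        "e2 * (\<kappa> * D (y n) (x n)) \<le> \<gamma> n 2 * (\<kappa> * D (y n) (x n))"
        using e2 n \<kappa> by (auto intro!: mult_right_mono)
      moreover have "0 \<le> e2 * D (w n) (z n)" "0 \<le> e2 * D (w n) (S (z n))" "0 \<le> e2 * (\<kappa> * D (y n) (x n))"
        using e2(1) \<kappa> by auto
      ultimately show "1 * D (us n) (w n) \<le> D p (x n) - D p (us n)" "e2 * D (w n) (z n) \<le> D p (x n) - D p (us n)"
        "e2 * D (w n) (S (z n)) \<le> D p (x n) - D p (us n)" "(e2 * \<kappa>) * D (y n) (x n) \<le> D p (x n) - D p (us n)"
        using us_le[OF n(1)] w_le[OF n(1)] D_nonneg[of "us n" "w n"] unfolding \<kappa>_def[symmetric] mult.assoc
        by linarith+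
    qed
    have D0: "(\<lambda>j. D (h (i j)) (x (i j))) \<longlonglongrightarrow> 0" "(\<lambda>j. D (h (i j)) (us (i j))) \<longlonglongrightarrow> 0"
      by (rule squeeze_to_0[OF D_nonneg gap_terms(1)[OF i(1,2)] e1(1) gap0]
          squeeze_to_0[OF D_nonneg gap_terms(2)[OF i(1,2)] e1(1) gap0])+
    have D0': "(\<lambda>j. D (us (i j)) (w (i j))) \<longlonglongrightarrow> 0" "(\<lambda>j. D (w (i j)) (z (i j))) \<longlonglongrightarrow> 0"
      "(\<lambda>j. D (w (i j)) (S (z (i j)))) \<longlonglongrightarrow> 0" "(\<lambda>j. D (y (i j)) (x (i j))) \<longlonglongrightarrow> 0"
      by (rule squeeze_to_0[OF D_nonneg P_terms(1)[OF i(1,3)] zero_less_one P0]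
          squeeze_to_0[OF D_nonneg P_terms(2)[OF i(1,3)] e2(1) P0]
          squeeze_to_0[OF D_nonneg P_terms(3)[OF i(1,3)] e2(1) P0]
          squeeze_to_0[OF D_nonneg P_terms(4)[OF i(1,3)] mult_pos_pos[OF e2(1) \<kappa>] P0])+
    note iBd = in_Bd[OF i(1)]
    have hx: "(\<lambda>j. h (i j) - x (i j)) \<longlonglongrightarrow> 0" by (rule D_tendsto_0_imp[OF Bd iBd(1) D0(1)])
    have hus: "(\<lambda>j. h (i j) - us (i j)) \<longlonglongrightarrow> 0" by (rule D_tendsto_0_imp[OF Bd iBd(3) D0(2)])
    have usw: "(\<lambda>j. us (i j) - w (i j)) \<longlonglongrightarrow> 0" by (rule D_tendsto_0_imp[OF Bd iBd(4) D0'(1)])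
    have wz: "(\<lambda>j. w (i j) - z (i j)) \<longlonglongrightarrow> 0" by (rule D_tendsto_0_imp[OF Bd iBd(5) D0'(2)])
    have wS: "(\<lambda>j. w (i j) - S (z (i j))) \<longlonglongrightarrow> 0" by (rule D_tendsto_0_imp[OF Bd iBd(6) D0'(3)])
    have yx: "(\<lambda>j. y (i j) - x (i j)) \<longlonglongrightarrow> 0" by (rule D_tendsto_0_imp[OF Bd iBd(1) D0'(4)])
    have usx: "(\<lambda>j. us (i j) - x (i j)) \<longlonglongrightarrow> 0" using tendsto_diff[OF hx hus] by simp
    have zx: "(\<lambda>j. z (i j) - x (i j)) \<longlonglongrightarrow> 0" using tendsto_diff[OF usx tendsto_add[OF usw wz]] by simp
    have zS: "(\<lambda>j. z (i j) - S (z (i j))) \<longlonglongrightarrow> 0" using tendsto_diff[OF wS wz] by simp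
    note hq = weakly_tendsto_add_null[OF xq hx] and usq = weakly_tendsto_add_null[OF xq usx]
      and zq = weakly_tendsto_add_null[OF xq zx] and yq = weakly_tendsto_add_null[OF xq yx]

    \<comment> \<open>Membership of the weak cluster point in \<Omega>\<close>
    have qC: "q \<in> C" by (rule weakly_sequentially_closed[OF C(2,3) xC[OF i(1)] xq])
    have "q \<in> asymptotic_fixed_points C S"
      unfolding asymptotic_fixed_points_def
      using qC zC[OF i(1)] zq tendsto_norm_zero[OF zS] by (intro CollectI conjI exI[of _ "\<lambda>j. z (i j)"]) auto
    then have qS: "q \<in> fixed_points C S" using \<open>asymptotic_fixed_points C S = fixed_points C S\<close> by simp

    have qg: "q \<in> equilibrium_set C g"
      unfolding equilibrium_set_def
    proof (intro CollectI conjI ballI qC)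
      fix q' assume q': "q' \<in> C"
      have x_bd: "bounded (range (\<lambda>j. x (i j)))" using Bd by (rule bounded_subset) (use in_Bd i in auto)
      \<comment> \<open>Boundedness of \<open>y\<close> comes from its closeness to
        \<open>x\<close>, obtained from a Bregman distance with the bounded iterate in second
        place.\<close>
      have "bounded (range (\<lambda>j. (y (i j) - x (i j)) + x (i j)))"
        using convergent_imp_bounded[OF yx] x_bd by (rule bounded_plus_comp)
      then have y_bd: "bounded (range (\<lambda>j. y (i j)))" by simp
      then have "bounded (range (\<lambda>j. q' - y (i j)))" by (intro bounded_minus_comp) auto
      moreover have "(\<lambda>j. G (y (i j)) - G (x (i j))) \<longlonglongrightarrow> 0"
        by (rule grad_diff_tendsto_0[of "range (\<lambda>j. x (i j)) \<union> range (\<lambda>j. y (i j))"]) (use x_bd y_bd yx in auto)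
      ultimately have E0: "(\<lambda>j. (G (y (i j)) - G (x (i j))) (q' - y (i j))) \<longlonglongrightarrow> 0"
        by (intro blinfun_apply_tendsto_0)
      have g_lim: "(\<lambda>j. g (s j) (t j)) \<longlonglongrightarrow> g p1 p2"
        if "\<And>j. s j \<in> C" "\<And>j. t j \<in> C" "p1 \<in> C" "p2 \<in> C" "weakly_tendsto s p1" "weakly_tendsto t p2" for s t p1 p2
        using A4 that unfolding weakly_continuous_bifun_def by simp
      have "(\<lambda>j. g (x (i j)) q' - g (x (i j)) (y (i j))) \<longlonglongrightarrow> g q q' - g q q"
        by (intro tendsto_diff g_lim xC yC i qC q' xq yq weakly_tendsto_const)
      moreover have "(\<lambda>j. - \<bar>(G (y (i j)) - G (x (i j))) (q' - y (i j))\<bar> / a) \<longlonglongrightarrow> - \<bar>0\<bar> / a"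
        using a_pos by (intro tendsto_intros E0) auto
      \<comment> \<open>The variable step \<open>lam n\<close> is replaced by its lower bound
        \<open>a\<close>: a nonnegative difference needs no bound, and for a negative one
        \<open>lam n * ?t \<le> a * ?t\<close>.\<close>
      moreover have "- \<bar>(G (y n) - G (x n)) (q' - y n)\<bar> / a \<le> g (x n) q' - g (x n) (y n)" if n: "n \<ge> 1" for n
      proof -
        let ?t = "g (x n) q' - g (x n) (y n)" and ?E = "(G (y n) - G (x n)) (q' - y n)"
        have "- \<bar>?E\<bar> \<le> lam n * ?t" using y_opt[OF n q'] by linarith
        show ?thesis
        proof (cases "0 \<le> ?t")
          case True
          have "- \<bar>?E\<bar> / a \<le> 0" using a_pos by simp
          then show ?thesis using True by linarith
        next
          case False
          then have "lam n * ?t \<le> a * ?t" using lam_range[OF n] by (intro mult_right_mono_neg) auto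
          then have "- \<bar>?E\<bar> \<le> a * ?t" using \<open>- \<bar>?E\<bar> \<le> lam n * ?t\<close> by linarith
          then show ?thesis using a_pos by (simp only: pos_divide_le_eq mult.commute)
        qed
      qed
      ultimately have "- \<bar>0\<bar> / a \<le> g q q' - g q q" using i(1) by (intro LIMSEQ_le) auto
      then have "0 \<le> g q q'" using g_diag[OF qC] by simp
      \<comment> \<open>The limit gave the inequality at \<open>q\<close>; pseudomonotonicity
        reverses the arguments as \<open>equilibrium_set\<close> demands.\<close>
      then show "g q' q \<le> 0" using A2 qC q' unfolding pseudomonotone_bifun_def by blast
    qed

    have q\<phi>: "q \<in> equilibrium_set C \<phi>"
      unfolding equilibrium_set_def
    proof (intro CollectI conjI ballI qC)
      fix q' assume q': "q' \<in> C"
      have us_bd: "bounded (range (\<lambda>j. us (i j)))" using Bd by (rule bounded_subset) (use in_Bd i in auto)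
      then have "bounded (range (\<lambda>j. q' - us (i j)))" by (intro bounded_minus_comp) auto
      moreover have "(\<lambda>j. G (us (i j)) - G (w (i j))) \<longlonglongrightarrow> 0"
        by (rule grad_diff_tendsto_0[OF Bd _ _ usw]) (use in_Bd i in auto)
      ultimately have E0: "(\<lambda>j. (G (us (i j)) - G (w (i j))) (q' - us (i j))) \<longlonglongrightarrow> 0"
        by (intro blinfun_apply_tendsto_0)
      have \<phi>_le: "\<phi> q' (us n) \<le> (G (us n) - G (w n)) (q' - us n)" if n: "n \<ge> 1" for n
        using us[OF n] B2 q' unfolding monotone_bifun_def by fastforce
      \<comment> \<open>Convexity and lower semicontinuity make sublevel sets of
        \<open>\<phi> q'\<close> weakly closed. The slack \<open>\<epsilon>\<close> and the shift by
        \<open>N\<close> put the whole tail into one of them.\<close>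
      show "\<phi> q' q \<le> 0"
      proof (rule field_le_epsilon)
        fix \<epsilon> :: real assume "0 < \<epsilon>"
        then obtain N where N: "\<And>j. j \<ge> N \<Longrightarrow> (G (us (i j)) - G (w (i j))) (q' - us (i j)) < \<epsilon>"
          using order_tendstoD(2)[OF E0] by (auto simp: eventually_sequentially)
        have "us (i (j + N)) \<in> {s \<in> C. \<phi> q' s \<le> \<epsilon>}" for j
          using us[OF i(1)] \<phi>_le[OF i(1), of "j + N"] N[of "j + N"] by simp
        moreover have "weakly_tendsto (\<lambda>j. us (i (j + N))) q"
          unfolding weakly_tendsto_def
          by (intro allI LIMSEQ_ignore_initial_segment[of "\<lambda>j. blinfun_apply l (us (i j))" for l])
            (use usq in \<open>simp add: weakly_tendsto_def\<close>)
        ultimately have "q \<in> {s \<in> C. \<phi> q' s \<le> \<epsilon>}"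
          by (rule weakly_sequentially_closed[OF closed_sublevel[OF C(2) conjunct2[OF B4[OF q']]]
                convex_sublevel[OF conjunct1[OF B4[OF q']]]])
        then show "\<phi> q' q \<le> 0 + \<epsilon>" by simp
      qed
    qed

    \<comment> \<open>Sign of the limit of \<open>bb\<close>\<close>
    have "q \<in> \<Omega>" using qS qg q\<phi> unfolding \<Omega>' by blast
    then have "(G u - G p) (q - p) \<le> 0" using p_vi[of q] by (simp add: blinfun.diff_left)
    moreover have "(\<lambda>j. bb (i j)) \<longlonglongrightarrow> (G u - G p) (q - p)"
      using hq unfolding bb_def blinfun.diff_right weakly_tendsto_def by (intro tendsto_diff) auto
    then have "c \<le> (G u - G p) (q - p)" using m(2) by (intro LIMSEQ_le_const) (auto simp: i_def intro: less_imp_le)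
    ultimately show False using c by linarith
  qed

  \<comment> \<open>Strong convergence\<close>
  have "(\<lambda>n. D p (x n)) \<longlonglongrightarrow> 0"
    by (rule recursion_tendsto_0[of _ "\<lambda>n. \<alpha> n 1" bb gap, OF step _ bb_le gap_nonneg _ \<alpha>1_lim \<alpha>1_div gap_forces])
      (use \<alpha>_pos in auto)
  \<comment> \<open>The iterates are known to be bounded from index 1 on, so the sequence is shifted
    before \<open>D_tendsto_0_imp\<close> is applied.\<close>
  then have "(\<lambda>n. D p (x (Suc n))) \<longlonglongrightarrow> 0" by (rule LIMSEQ_Suc)
  then have "(\<lambda>n. p - x (Suc n)) \<longlonglongrightarrow> 0" by (intro D_tendsto_0_imp[OF Bd]) (auto intro: in_Bd)
  then have "(\<lambda>n. p - (p - x (Suc n))) \<longlonglongrightarrow> p - 0" by (intro tendsto_intros)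
  then have "(\<lambda>n. x (Suc n)) \<longlonglongrightarrow> p" by simp
  then show ?thesis unfolding p_def by (rule LIMSEQ_imp_Suc)
qed

end
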